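(* Let $A$ be a closed densely defined operator in a complex Hilbert space $\mathcal H$ and let $E$ be the spectral measure of $|A|$. Set $$\mathcal H_0=\operatorname{Lin}\{E(\sigma)Af\colon \sigma\in\mathfrak B(\mathbb R_+),\ f\in\mathcal D(A)\}.$$ Then the following two conditions are equivalent: (i) $\langle E(\cdot)|A|f,|A|f\rangle\ll\langle E(\cdot)Af,Af\rangle$ for every $f\in\mathcal D(A)$; (ii) there exists a (unique) linear map $T_0\colon\mathcal H_0\to\mathcal R(|A|)$ such that $T_0A=|A|$ and $T_0E(\sigma)|_{\mathcal H_0}=E(\sigma)T_0$ for all $\sigma\in\mathfrak B(\mathbb R_+)$. Moreover, the following assertion holds for any $c\in\mathbb R_+$: (iii) $A$ is weakly quasinormal with $\mathfrak c_A\leqslant c$ if and only if there is a map $T_0$ as in (ii) and it is bounded with $\|T_0\|\leqslant\sqrt c$.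
   Context: All operators are linear and possibly unbounded; $\mathcal D(A)$ and $\mathcal R(A)$ denote the domain and the range of $A$; $\operatorname{Lin}$ denotes the (algebraic, not closed) linear span. $\mathbb R_+=[0,\infty)$ and $\mathfrak B(\mathbb R_+)$ is its Borel $\sigma$-algebra. For a closed densely defined $A$, $|A|$ is the square root of the positive selfadjoint operator $A^*A$ (so $\mathcal D(|A|)=\mathcal D(A)$), and its spectral measure is regarded as defined on $\mathfrak B(\mathbb R_+)$. Note that $\mathcal R(A)\subseteq\mathcal H_0$ and $E(\sigma)\mathcal H_0\subseteq\mathcal H_0$ for all $\sigma\in\mathfrak B(\mathbb R_+)$, so the equalities in (ii) make sense. For finite positive Borel measures on $\mathbb R_+$, $\mu\ll\nu$ means $\mu$ is absolutely continuous with respect to $\nu$; $\langle E(\cdot)h,h\rangle$ is the measure $\sigma\mapsto\langle E(\sigma)h,h\rangle$. A closed densely defined operator $A$ in $\mathcal H$ is called weakly quasinormal if there exists $c\in\mathbb R_+$ such that $\langle E(\sigma)|A|f,|A|f\rangle\leqslant c\,\langle E(\sigma)Af,Af\rangle$ for all $\sigma\in\mathfrak B(\mathbb R_+)$ and $f\in\mathcal D(A)$, where $E$ is the spectral measure of $|A|$; the smallest such $c$ is denoted by $\mathfrak c_A$. *)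

theory Defs
  imports "HOL-Analysis.Analysis"
begin

section \<open>Complex Hilbert spaces\<close>

text \<open>
  A complex Hilbert space is a real Hilbert space (whose norm and topology we inherit) together
  with a complex scalar multiplication and a complex inner product, linear in its \<^emph>\<open>first\<close>
  argument, whose real part is the given real inner product.
\<close>

class chilbert_space = real_inner + complete_space +
  fixes scaleC :: "complex \<Rightarrow> 'a \<Rightarrow> 'a"  (infixr \<open>*\<^sub>C\<close> 75)
    and cinner :: "'a \<Rightarrow> 'a \<Rightarrow> complex"
  assumes scaleC_add_right: "c *\<^sub>C (x + y) = c *\<^sub>C x + c *\<^sub>C y"
    and scaleC_add_left: "(c + d) *\<^sub>C x = c *\<^sub>C x + d *\<^sub>C x"
    and scaleC_scaleC: "c *\<^sub>C (d *\<^sub>C x) = (c * d) *\<^sub>C x"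
    and scaleR_scaleC: "r *\<^sub>R x = complex_of_real r *\<^sub>C x"
    and cinner_commute: "cinner x y = cnj (cinner y x)"
    and cinner_add_left: "cinner (x + y) z = cinner x z + cinner y z"
    and cinner_scaleC_left: "cinner (c *\<^sub>C x) y = c * cinner x y"
    and inner_eq_Re_cinner: "inner x y = Re (cinner x y)"

instantiation complex :: chilbert_space
begin
definition scaleC_complex :: "complex \<Rightarrow> complex \<Rightarrow> complex" where
  "scaleC_complex c x = c * x"
definition cinner_complex :: "complex \<Rightarrow> complex \<Rightarrow> complex" where
  "cinner_complex x y = x * cnj y"
instance
  by standard
    (auto simp: scaleC_complex_def cinner_complex_def algebra_simps scaleR_conv_of_real
      inner_complex_def)
end

global_interpretation cvec: vector_space "scaleC :: complex \<Rightarrow> 'a \<Rightarrow> 'a::chilbert_space"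
proof
  fix x :: 'a
  show "1 *\<^sub>C x = x"
    using scaleR_scaleC[of 1 x] by simp
qed (auto simp: scaleC_add_right scaleC_add_left scaleC_scaleC)


section \<open>Unbounded operators\<close>

text \<open>
  Operators are partial functions: \<^term>\<open>dom A\<close> is the domain, \<^term>\<open>ran A\<close> the range,
  \<^term>\<open>B \<circ>\<^sub>m A\<close> the product (with its natural domain), and equality of partial functions
  includes equality of domains.
\<close>

type_synonym 'a oper = "'a \<rightharpoonup> 'a"

abbreviation ap :: "'a oper \<Rightarrow> 'a \<Rightarrow> 'a" where
  "ap A f \<equiv> the (A f)"

definition lin_oper :: "'a::chilbert_space oper \<Rightarrow> bool" where
  "lin_oper A \<longleftrightarrow> cvec.subspace (dom A) \<and>
     (\<forall>f\<in>dom A. \<forall>g\<in>dom A. ap A (f + g) = ap A f + ap A g) \<and>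
     (\<forall>c. \<forall>f\<in>dom A. ap A (c *\<^sub>C f) = c *\<^sub>C ap A f)"

definition densely_defined :: "'a::chilbert_space oper \<Rightarrow> bool" where
  "densely_defined A \<longleftrightarrow> closure (dom A) = UNIV"

definition closed_oper :: "'a::chilbert_space oper \<Rightarrow> bool" where
  "closed_oper A \<longleftrightarrow> closed (Map.graph A)"

text \<open>The adjoint; meaningful for densely defined \<open>A\<close>, where the vector \<open>h\<close> is unique.\<close>

definition adjoint_oper :: "'a::chilbert_space oper \<Rightarrow> 'a oper" where
  "adjoint_oper A = (\<lambda>g.
     if \<exists>h. \<forall>f\<in>dom A. cinner (ap A f) g = cinner f h
     then Some (THE h. \<forall>f\<in>dom A. cinner (ap A f) g = cinner f h)
     else None)"

definition selfadjoint_oper :: "'a::chilbert_space oper \<Rightarrow> bool" where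
  "selfadjoint_oper B \<longleftrightarrow> lin_oper B \<and> densely_defined B \<and> adjoint_oper B = B"

definition positive_oper :: "'a::chilbert_space oper \<Rightarrow> bool" where
  "positive_oper B \<longleftrightarrow>
     (\<forall>f\<in>dom B. cinner (ap B f) f \<in> \<real> \<and> 0 \<le> Re (cinner (ap B f) f))"

text \<open>\<open>is_modulus A B\<close> says that \<open>B\<close> is \<open>|A|\<close>, the positive selfadjoint square root of \<open>A\<^sup>*A\<close>.\<close>

definition is_modulus :: "'a::chilbert_space oper \<Rightarrow> 'a oper \<Rightarrow> bool" where
  "is_modulus A B \<longleftrightarrow> selfadjoint_oper B \<and> positive_oper B \<and>
     B \<circ>\<^sub>m B = adjoint_oper A \<circ>\<^sub>m A"

text \<open>Norm of a bounded operator whose domain is a (not necessarily closed) linear subspace;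
  as in \<^const>\<open>onorm\<close>, the vector 0 contributes \<open>0 / 0 = 0\<close>.\<close>

definition bounded_oper :: "'a::chilbert_space oper \<Rightarrow> bool" where
  "bounded_oper T \<longleftrightarrow> (\<exists>M. \<forall>h\<in>dom T. norm (ap T h) \<le> M * norm h)"

definition oper_norm :: "'a::chilbert_space oper \<Rightarrow> real" where
  "oper_norm T = (SUP h\<in>dom T. norm (ap T h) / norm h)"


section \<open>Spectral measures on the half-line\<close>

abbreviation borel_Rplus :: "real measure" where
  "borel_Rplus \<equiv> restrict_space borel {0..}"

definition orth_projection :: "('a::chilbert_space \<Rightarrow> 'a) \<Rightarrow> bool" where
  "orth_projection P \<longleftrightarrow> Vector_Spaces.linear scaleC scaleC P \<and>
     (\<forall>x. P (P x) = P x) \<and> (\<forall>x y. cinner (P x) y = cinner x (P y))"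

text \<open>The values of \<open>E\<close> off the Borel subsets of the half-line are irrelevant.\<close>

definition spectral_measure :: "(real set \<Rightarrow> 'a::chilbert_space \<Rightarrow> 'a) \<Rightarrow> bool" where
  "spectral_measure E \<longleftrightarrow>
     (\<forall>\<sigma>\<in>sets borel_Rplus. orth_projection (E \<sigma>)) \<and>
     (\<forall>h. E {0..} h = h) \<and>
     (\<forall>S::nat \<Rightarrow> real set. range S \<subseteq> sets borel_Rplus \<longrightarrow> disjoint_family S \<longrightarrow>
        (\<forall>h. (\<lambda>n. E (S n) h) sums E (\<Union>n. S n) h))"

text \<open>The finite positive Borel measure mapping \<open>\<sigma>\<close> to \<open>\<langle>E(\<sigma>)h, h\<rangle>\<close>.\<close>

definition vec_measure :: "(real set \<Rightarrow> 'a::chilbert_space \<Rightarrow> 'a) \<Rightarrow> 'a \<Rightarrow> real measure" where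
  "vec_measure E h =
     measure_of {0..} (sets borel_Rplus) (\<lambda>\<sigma>. ennreal (Re (cinner (E \<sigma> h) h)))"

text \<open>
  \<open>is_spectral_measure_of B E\<close> says that \<open>E\<close> is the spectral measure of the positive selfadjoint
  operator \<open>B\<close>, that is, \<open>B\<close> is the spectral integral of the identity function \<open>t\<close>.
  By polarization the quadratic form determines the linear operator \<open>B\<close> on its dense domain.
\<close>

definition is_spectral_measure_of ::
  "'a::chilbert_space oper \<Rightarrow> (real set \<Rightarrow> 'a \<Rightarrow> 'a) \<Rightarrow> bool" where
  "is_spectral_measure_of B E \<longleftrightarrow> spectral_measure E \<and>
     dom B = {f. (\<integral>\<^sup>+ t. ennreal (t\<^sup>2) \<partial>vec_measure E f) < \<infinity>} \<and>
     (\<forall>f\<in>dom B. cinner (ap B f) f = complex_of_real (\<integral>t. t \<partial>vec_measure E f))"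


section \<open>Weakly quasinormal operators\<close>

text \<open>
  \<open>|A|\<close> and its spectral measure \<open>E\<close> exist and are unique by the spectral theorem, so the
  quantifier over \<open>B\<close> and \<open>E\<close> merely names them.
\<close>

definition wq_bound :: "'a::chilbert_space oper \<Rightarrow> real \<Rightarrow> bool" where
  "wq_bound A c \<longleftrightarrow> 0 \<le> c \<and>
     (\<exists>B E. is_modulus A B \<and> is_spectral_measure_of B E \<and>
        (\<forall>\<sigma>\<in>sets borel_Rplus. \<forall>f\<in>dom A.
           Re (cinner (E \<sigma> (ap B f)) (ap B f)) \<le> c * Re (cinner (E \<sigma> (ap A f)) (ap A f))))"

definition weakly_quasinormal :: "'a::chilbert_space oper \<Rightarrow> bool" where
  "weakly_quasinormal A \<longleftrightarrow>
     lin_oper A \<and> closed_oper A \<and> densely_defined A \<and> (\<exists>c. wq_bound A c)"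

definition wq_const :: "'a::chilbert_space oper \<Rightarrow> real" where
  "wq_const A = (LEAST c. wq_bound A c)"


section \<open>The intertwining map on \<open>\<H>\<^sub>0\<close>\<close>

definition H0 :: "'a::chilbert_space oper \<Rightarrow> (real set \<Rightarrow> 'a \<Rightarrow> 'a) \<Rightarrow> 'a set" where
  "H0 A E = cvec.span {E \<sigma> (ap A f) | \<sigma> f. \<sigma> \<in> sets borel_Rplus \<and> f \<in> dom A}"

text \<open>
  \<open>T\<close> is a linear map from \<open>\<H>\<^sub>0\<close> to the range of \<open>B = |A|\<close> with \<open>T A = |A|\<close> that commutes with
  \<open>E\<close> on \<open>\<H>\<^sub>0\<close>.
\<close>

definition intertwiner ::
  "'a::chilbert_space oper \<Rightarrow> 'a oper \<Rightarrow> (real set \<Rightarrow> 'a \<Rightarrow> 'a) \<Rightarrow> 'a oper \<Rightarrow> bool" where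
  "intertwiner A B E T \<longleftrightarrow>
     lin_oper T \<and> dom T = H0 A E \<and> ran T \<subseteq> ran B \<and> T \<circ>\<^sub>m A = B \<and>
     (\<forall>\<sigma>\<in>sets borel_Rplus. \<forall>h\<in>H0 A E. T (E \<sigma> h) = Some (E \<sigma> (ap T h)))"

end

theory Submission
  imports Defs
begin

text \<open>
  If \<open>\<Sum>\<^sub>j E(\<sigma>\<^sub>j) A f\<^sub>j\<close> is given, refining the sets to disjoint ones and using linearity of \<open>A\<close>
  turns it into an orthogonal sum of vectors \<open>E(\<omega>) A g\<^sub>\<omega>\<close>, and the same refinement turns
  \<open>\<Sum>\<^sub>j E(\<sigma>\<^sub>j) |A| f\<^sub>j\<close> into the orthogonal sum of the \<open>E(\<omega>) |A| g\<^sub>\<omega>\<close>. Hence an implication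
  \<open>E(\<omega>) A g = 0 \<Longrightarrow> E(\<omega>) |A| g = 0\<close>, or an inequality \<open>\<parallel>E(\<omega>) |A| g\<parallel>\<^sup>2 \<le> c \<parallel>E(\<omega>) A g\<parallel>\<^sup>2\<close>, passes
  from single vectors to sums, and \<open>E(\<sigma>) A f \<mapsto> E(\<sigma>) |A| f\<close> extends to a (bounded) linear map.
  Three facts about \<open>|A|\<close> are needed besides: \<open>E\<close> commutes with \<open>|A|\<close>, which follows from
  additivity of the quadratic form of \<open>|A|\<close> under \<open>h \<mapsto> E(\<sigma>) h\<close>; the domains of \<open>A\<close> and \<open>|A|\<close>
  agree, by truncation with \<open>E([0, n])\<close>; and \<open>|A|\<close> and \<open>E\<close> are determined by \<open>A\<^sup>* A\<close>, because
  \<open>A\<^sup>* A\<close> is at most \<open>a\<^sup>2\<close> on the range of \<open>E([0, a])\<close> and at least \<open>b\<^sup>2\<close> on that of \<open>E((b, \<infinity>))\<close>.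
\<close>

section \<open>Operators and projections\<close>

lemma lin_oper_zero: "lin_oper A \<Longrightarrow> 0 \<in> dom A"
  by (simp add: lin_oper_def cvec.subspace_0)

lemma lin_oper_add:
  assumes "lin_oper A" "f \<in> dom A" "g \<in> dom A"
  shows "f + g \<in> dom A" "ap A (f + g) = ap A f + ap A g"
  using assms by (simp_all add: lin_oper_def cvec.subspace_add)

lemma lin_oper_scaleC:
  assumes "lin_oper A" "f \<in> dom A"
  shows "c *\<^sub>C f \<in> dom A" "ap A (c *\<^sub>C f) = c *\<^sub>C ap A f"
  using assms by (simp_all add: lin_oper_def cvec.subspace_scale)

lemma lin_oper_scaleR:
  assumes "lin_oper A" "f \<in> dom A"
  shows "r *\<^sub>R f \<in> dom A" "ap A (r *\<^sub>R f) = r *\<^sub>R ap A f"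
  using lin_oper_scaleC[OF assms] by (simp_all add: scaleR_scaleC)

lemma lin_oper_diff:
  assumes "lin_oper A" "f \<in> dom A" "g \<in> dom A"
  shows "f - g \<in> dom A" "ap A (f - g) = ap A f - ap A g"
  using lin_oper_add[OF assms(1,2) lin_oper_scaleR(1)[OF assms(1,3), of "-1"]]
    lin_oper_scaleR(2)[OF assms(1,3), of "-1"] by simp_all

text \<open>The imaginary part is the real identity tested at \<open>\<i> *\<^sub>C f\<close>.
  Arguments can thus run with \<open>inner\<close> and return to \<open>cinner\<close> only where
  the adjoint demands it.\<close>

lemma cinner_eqI:
  assumes "lin_oper A"
    and "\<And>f. f \<in> dom A \<Longrightarrow> inner (ap A f) g = inner f h"
    and "f \<in> dom A"
  shows "cinner (ap A f) g = cinner f h"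
proof (rule complex_eqI)
  show "Re (cinner (ap A f) g) = Re (cinner f h)"
    using assms(2)[OF assms(3)] by (simp add: inner_eq_Re_cinner)
  have "inner (ap A (\<i> *\<^sub>C f)) g = inner (\<i> *\<^sub>C f) h"
    using assms(2) lin_oper_scaleC(1)[OF assms(1,3)] by blast
  then show "Im (cinner (ap A f) g) = Im (cinner f h)"
    by (simp add: lin_oper_scaleC[OF assms(1,3)] inner_eq_Re_cinner cinner_scaleC_left)
qed

lemma dense_orthogonal_zero:
  assumes "densely_defined A" "\<And>f. f \<in> dom A \<Longrightarrow> inner f h = 0"
  shows "h = (0::'a::chilbert_space)"
proof -
  have "closed {f. inner f h = 0}"
    by (intro closed_Collect_eq continuous_intros)
  then have "closure (dom A) \<subseteq> {f. inner f h = 0}"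
    using assms(2) by (intro closure_minimal) auto
  then have "inner h h = 0"
    using assms(1) unfolding densely_defined_def by blast
  then show ?thesis by simp
qed

text \<open>Density makes the representing vector unique, which resolves the \<open>THE\<close> in
  the adjoint.\<close>

lemma adjoint_oper_SomeI:
  fixes h :: "'a::chilbert_space"
  assumes "densely_defined A" "\<And>f. f \<in> dom A \<Longrightarrow> cinner (ap A f) g = cinner f h"
  shows "adjoint_oper A g = Some h"
proof -
  have "h' = h" if "\<forall>f\<in>dom A. cinner (ap A f) g = cinner f h'" for h'
  proof -
    have "inner f (h' - h) = 0" if "f \<in> dom A" for f
      using assms(2)[OF that] \<open>\<forall>f\<in>dom A. _\<close> that
      by (metis inner_diff_right inner_eq_Re_cinner cancel_comm_monoid_add_class.diff_cancel)
    from dense_orthogonal_zero[OF assms(1) this] show ?thesis by simp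
  qed
  then have "(THE h. \<forall>f\<in>dom A. cinner (ap A f) g = cinner f h) = h"
    using assms(2) by (intro the_equality) auto
  then show ?thesis
    using assms(2) unfolding adjoint_oper_def by auto
qed

lemma adjoint_oper_inner:
  assumes "densely_defined A" "adjoint_oper A g = Some h" "f \<in> dom A"
  shows "inner (ap A f) g = inner f h"
proof -
  obtain h' where h': "\<And>f. f \<in> dom A \<Longrightarrow> cinner (ap A f) g = cinner f h'"
    using assms(2) unfolding adjoint_oper_def by (auto split: if_splits)
  then have "h' = h"
    using adjoint_oper_SomeI[OF assms(1) h'] assms(2) by simp
  then show ?thesis
    using h'[OF assms(3)] by (simp add: inner_eq_Re_cinner)
qed

lemma closed_operD:
  assumes "closed_oper A" "\<And>n. f n \<in> dom A" "f \<longlonglongrightarrow> l" "(\<lambda>n. ap A (f n)) \<longlonglongrightarrow> k"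
  shows "A l = Some k"
proof -
  have "\<And>n. (f n, ap A (f n)) \<in> Map.graph A"
    using assms(2) by (auto simp: Map.graph_def dom_def)
  moreover have "(\<lambda>n. (f n, ap A (f n))) \<longlonglongrightarrow> (l, k)"
    using assms(3,4) by (rule tendsto_Pair)
  ultimately have "(l, k) \<in> Map.graph A"
    using assms(1) closed_sequentially[of "Map.graph A" "\<lambda>n. (f n, ap A (f n))"]
    unfolding closed_oper_def by blast
  then show ?thesis by (simp add: Map.graph_def)
qed

lemma orth_projectionD:
  assumes "orth_projection P"
  shows "linear P" "P (P x) = P x" "inner (P x) y = inner x (P y)" "P (c *\<^sub>C x) = c *\<^sub>C P x"
    "inner (P x) x = (norm (P x))\<^sup>2" "norm (P x) \<le> norm x"
proof -
  have lin: "Vector_Spaces.linear scaleC scaleC P" and idem: "\<And>x. P (P x) = P x"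
    and sym: "\<And>x y. cinner (P x) y = cinner x (P y)"
    using assms unfolding orth_projection_def by auto
  interpret Vector_Spaces.linear scaleC scaleC P by (rule lin)
  show "P (c *\<^sub>C x) = c *\<^sub>C P x" by (rule scale)
  show "linear P" by (rule linearI) (simp_all add: add scale scaleR_scaleC)
  show "P (P x) = P x" by (rule idem)
  show sym': "inner (P x) y = inner x (P y)" for x y
    by (simp add: inner_eq_Re_cinner sym)
  show *: "inner (P x) x = (norm (P x))\<^sup>2" for x
    using sym'[of "P x" x] by (simp add: idem power2_norm_eq_inner inner_commute)
  have "(norm (P x))\<^sup>2 \<le> norm (P x) * norm x"
    using norm_cauchy_schwarz[of "P x" x] * by simp
  then show "norm (P x) \<le> norm x"
    by (cases "norm (P x) = 0") (auto simp: power2_eq_square)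
qed

text \<open>Taking adjoints in \<open>P Q = Q\<close> gives \<open>Q P = Q\<close>, to be compared
  with \<open>Q P = P\<close>.\<close>

lemma orth_projection_eqI:
  assumes "orth_projection P" "orth_projection Q"
    and "\<And>x. Q (P x) = P x" "\<And>x. P (Q x) = Q x"
  shows "P x = Q x"
proof -
  have "inner (P x) y = inner (Q x) y" for y
    using assms by (metis orth_projectionD(3))
  then show ?thesis by (metis inner_commute vector_eq_ldot)
qed

section \<open>Spectral measures\<close>

lemma sets_borel_Rplus: "\<sigma> \<in> sets borel_Rplus \<longleftrightarrow> \<sigma> \<subseteq> {0..} \<and> \<sigma> \<in> sets borel"
  by (intro sets_restrict_space_iff) auto

locale spectral_family =
  fixes E :: "real set \<Rightarrow> 'a::chilbert_space \<Rightarrow> 'a"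
  assumes spectral: "spectral_measure E"
begin

section \<open>Algebra of the spectral projections\<close>

lemma proj: "\<sigma> \<in> sets borel_Rplus \<Longrightarrow> orth_projection (E \<sigma>)"
  and E_top: "E {0..} h = h"
  and E_sums: "range S \<subseteq> sets borel_Rplus \<Longrightarrow> disjoint_family S \<Longrightarrow>
    (\<lambda>n. E (S n) h) sums E (\<Union>n. S n) h"
  using spectral unfolding spectral_measure_def by auto

lemmas E_linear = orth_projectionD(1)[OF proj]
lemmas E_idem = orth_projectionD(2)[OF proj]
lemmas E_sym = orth_projectionD(3)[OF proj]
lemmas E_scaleC = orth_projectionD(4)[OF proj]
lemmas E_inner = orth_projectionD(5)[OF proj]
lemmas E_norm_le = orth_projectionD(6)[OF proj]
lemmas E_add = linear_add[OF E_linear]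
lemmas E_diff = linear_diff[OF E_linear]
lemmas E_zero = linear_0[OF E_linear]

text \<open>Countable additivity for the constant sequence \<open>{}\<close> gives a convergent
  series with constant terms, so these terms vanish.\<close>

lemma E_empty: "E {} h = 0"
proof -
  have "(\<lambda>n::nat. E {} h) sums E (\<Union>n::nat. {}) h"
    by (rule E_sums) (auto simp: disjoint_family_on_def)
  then have "(\<lambda>n::nat. E {} h) \<longlonglongrightarrow> 0"
    by (intro summable_LIMSEQ_zero sums_summable)
  then show ?thesis by (simp add: LIMSEQ_const_iff)
qed

lemma E_Un_disjoint:
  assumes "\<sigma> \<in> sets borel_Rplus" "\<tau> \<in> sets borel_Rplus" "\<sigma> \<inter> \<tau> = {}"
  shows "E (\<sigma> \<union> \<tau>) h = E \<sigma> h + E \<tau> h"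
proof -
  have "(\<lambda>n. E (binaryset \<sigma> \<tau> n) h) sums E (\<Union>n. binaryset \<sigma> \<tau> n) h"
    using assms by (intro E_sums) (auto simp: range_binaryset_eq disjoint_family_on_def binaryset_def)
  moreover have "(\<lambda>n. E (binaryset \<sigma> \<tau> n) h) sums (\<Sum>n\<in>{0,1}. E (binaryset \<sigma> \<tau> n) h)"
    by (rule sums_finite) (auto simp: binaryset_def E_empty)
  ultimately show ?thesis
    by (simp add: UN_binaryset_eq sums_iff binaryset_def)
qed

text \<open>For a vector \<open>?h\<close> in the range of \<open>E \<tau>\<close>, additivity gives
  the form of \<open>E (\<sigma> \<union> \<tau>)\<close> at \<open>?h\<close> the value
  \<open>(norm ?h)\<^sup>2\<close> plus the square of interest, while a projection allows at most
  \<open>(norm ?h)\<^sup>2\<close>.\<close>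

lemma E_disjoint:
  assumes "\<sigma> \<in> sets borel_Rplus" "\<tau> \<in> sets borel_Rplus" "\<sigma> \<inter> \<tau> = {}"
  shows "E \<sigma> (E \<tau> h) = 0"
proof -
  have un: "\<sigma> \<union> \<tau> \<in> sets borel_Rplus"
    using assms(1,2) by (rule sets.Un)
  let ?h = "E \<tau> h"
  have "inner (E (\<sigma> \<union> \<tau>) ?h) ?h = (norm (E \<sigma> ?h))\<^sup>2 + (norm ?h)\<^sup>2"
    using assms by (simp add: E_Un_disjoint inner_add_left E_inner E_idem
        flip: power2_norm_eq_inner)
  moreover have "inner (E (\<sigma> \<union> \<tau>) ?h) ?h \<le> (norm ?h)\<^sup>2"
    using E_inner[OF un] E_norm_le[OF un] by (simp add: power_mono)
  ultimately show ?thesis by simp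
qed

text \<open>Both sets are split along their intersection; the products over disjoint pieces
  vanish.\<close>

lemma E_Int:
  assumes "\<sigma> \<in> sets borel_Rplus" "\<tau> \<in> sets borel_Rplus"
  shows "E \<sigma> (E \<tau> h) = E (\<sigma> \<inter> \<tau>) h"
proof -
  have s: "\<sigma> \<inter> \<tau> \<in> sets borel_Rplus" "\<sigma> - \<tau> \<in> sets borel_Rplus" "\<tau> - \<sigma> \<in> sets borel_Rplus"
    using assms by (simp_all only: sets.Int sets.Diff)
  have "\<sigma> \<inter> \<tau> \<union> (\<tau> - \<sigma>) = \<tau>" "\<sigma> \<inter> \<tau> \<union> (\<sigma> - \<tau>) = \<sigma>" by auto
  then have \<tau>: "E \<tau> g = E (\<sigma> \<inter> \<tau>) g + E (\<tau> - \<sigma>) g"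
    and \<sigma>: "E \<sigma> g = E (\<sigma> \<inter> \<tau>) g + E (\<sigma> - \<tau>) g" for g
    using E_Un_disjoint[OF s(1,3), of g] E_Un_disjoint[OF s(1,2), of g] by auto
  have "E (\<sigma> - \<tau>) (E \<tau> h) = 0"
    by (rule E_disjoint[OF s(2) assms(2)]) auto
  moreover have "E (\<sigma> \<inter> \<tau>) (E (\<tau> - \<sigma>) h) = 0"
    by (rule E_disjoint[OF s(1,3)]) auto
  ultimately show ?thesis
    using \<sigma>[of "E \<tau> h"] \<tau>[of h] by (simp add: E_add[OF s(1)] E_idem[OF s(1)])
qed

lemma E_Diff:
  assumes "\<sigma> \<in> sets borel_Rplus"
  shows "E ({0..} - \<sigma>) h = h - E \<sigma> h" "{0..} - \<sigma> \<in> sets borel_Rplus"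
proof -
  show s: "{0..} - \<sigma> \<in> sets borel_Rplus"
    using assms by (auto simp: sets_borel_Rplus)
  have "\<sigma> \<union> ({0..} - \<sigma>) = {0..}"
    using assms by (auto simp: sets_borel_Rplus)
  then show "E ({0..} - \<sigma>) h = h - E \<sigma> h"
    using E_Un_disjoint[OF assms s, of h] E_top[of h] by (metis Diff_disjoint add_diff_cancel_left')
qed

lemma norm_E_split:
  assumes "\<sigma> \<in> sets borel_Rplus"
  shows "(norm (E \<sigma> h))\<^sup>2 + (norm (h - E \<sigma> h))\<^sup>2 = (norm h)\<^sup>2"
proof -
  have "inner (E \<sigma> h) (h - E \<sigma> h) = 0"
    using assms by (simp add: inner_diff_right E_inner power2_norm_eq_inner)
  then show ?thesis
    by (simp add: power2_norm_eq_inner inner_diff_left inner_diff_right inner_commute)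
qed

section \<open>The scalar measure of a vector\<close>

lemma space_vec_measure [simp]: "space (vec_measure E h) = {0..}"
  and sets_vec_measure: "sets (vec_measure E h) = sets borel_Rplus"
proof -
  have "sets borel_Rplus \<subseteq> Pow {0..}"
    by (auto simp: sets_borel_Rplus)
  moreover have "sigma_sets {0..} (sets borel_Rplus) = sets borel_Rplus"
    using sets.sigma_sets_eq[of borel_Rplus] by (simp add: space_restrict_space)
  ultimately show "space (vec_measure E h) = {0..}" "sets (vec_measure E h) = sets borel_Rplus"
    unfolding vec_measure_def by (simp_all add: space_measure_of sets_measure_of)
qed

text \<open>\<open>measure_of\<close> reproduces the given set function only once it is known to be
  a measure; countable additivity comes from that of \<open>E\<close> by continuity of the inner
  product.\<close>

lemma emeasure_vec_measure:
  assumes "\<sigma> \<in> sets borel_Rplus"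
  shows "emeasure (vec_measure E h) \<sigma> = ennreal ((norm (E \<sigma> h))\<^sup>2)"
proof -
  have eq: "Re (cinner (E \<sigma> h) h) = (norm (E \<sigma> h))\<^sup>2" if "\<sigma> \<in> sets borel_Rplus" for \<sigma>
    using E_inner[OF that] by (simp add: inner_eq_Re_cinner)
  have "countably_additive (sets borel_Rplus) (\<lambda>\<sigma>. ennreal (Re (cinner (E \<sigma> h) h)))"
  proof (rule countably_additiveI)
    fix S :: "nat \<Rightarrow> real set"
    assume S: "range S \<subseteq> sets borel_Rplus" "disjoint_family S" "\<Union> (range S) \<in> sets borel_Rplus"
    have "(\<lambda>n. inner (E (S n) h) h) sums inner (E (\<Union>n. S n) h) h"
      using E_sums[OF S(1,2)] by (intro bounded_linear.sums[OF bounded_linear_inner_left])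
    moreover have "inner (E (S n) h) h \<ge> 0" for n
      using S(1) E_inner[of "S n"] by auto
    ultimately show "(\<Sum>n. ennreal (Re (cinner (E (S n) h) h))) =
        ennreal (Re (cinner (E (\<Union> (range S)) h) h))"
      unfolding inner_eq_Re_cinner by (rule suminf_ennreal_eq[rotated])
  qed
  moreover have "positive (sets borel_Rplus) (\<lambda>\<sigma>. ennreal (Re (cinner (E \<sigma> h) h)))"
    by (auto simp: positive_def E_empty simp flip: inner_eq_Re_cinner)
  moreover have "sigma_algebra {0..} (sets borel_Rplus)"
    using sets.sigma_algebra_axioms[of borel_Rplus] by (simp add: space_restrict_space)
  ultimately show ?thesis
    unfolding vec_measure_def using assms
    by (subst emeasure_measure_of_sigma) (auto simp: eq)
qed

text \<open>Turns absolute continuity into an implication between vanishing projections of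
  vectors.\<close>

lemma null_sets_vec_measure:
  "\<sigma> \<in> null_sets (vec_measure E h) \<longleftrightarrow> \<sigma> \<in> sets borel_Rplus \<and> E \<sigma> h = 0"
proof (cases "\<sigma> \<in> sets borel_Rplus")
  case True
  then show ?thesis
    unfolding null_sets_def by (simp only: mem_Collect_eq sets_vec_measure emeasure_vec_measure) simp
qed (simp only: null_sets_def mem_Collect_eq sets_vec_measure simp_thms)

lemma measurable_vec_measure:
  "f \<in> borel_measurable borel \<Longrightarrow> f \<in> borel_measurable (vec_measure E h)"
  unfolding measurable_cong_sets[OF sets_vec_measure refl] by (rule measurable_restrict_space1)

text \<open>By multiplicativity of \<open>E\<close>, projecting the vector restricts its measure to
  \<open>\<tau>\<close>; integrals for \<open>E \<tau> h\<close> become integrals over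
  \<open>\<tau>\<close> for \<open>h\<close>.\<close>

lemma vec_measure_E:
  assumes "\<tau> \<in> sets borel_Rplus"
  shows "vec_measure E (E \<tau> h) = density (vec_measure E h) (indicator \<tau>)"
proof (rule measure_eqI)
  fix \<sigma> assume "\<sigma> \<in> sets (vec_measure E (E \<tau> h))"
  then have s: "\<sigma> \<in> sets borel_Rplus" by (simp add: sets_vec_measure)
  then have i: "\<sigma> \<inter> \<tau> \<in> sets borel_Rplus" using assms by (rule sets.Int)
  have "emeasure (density (vec_measure E h) (indicator \<tau>)) \<sigma> =
      (\<integral>\<^sup>+ t. indicator \<tau> t * indicator \<sigma> t \<partial>vec_measure E h)"
    using s assms by (intro emeasure_density borel_measurable_indicator) (simp_all only: sets_vec_measure)
  also have "\<dots> = (\<integral>\<^sup>+ t. indicator (\<sigma> \<inter> \<tau>) t \<partial>vec_measure E h)"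
    by (intro nn_integral_cong) (simp split: split_indicator)
  also have "\<dots> = emeasure (vec_measure E h) (\<sigma> \<inter> \<tau>)"
    using i by (intro nn_integral_indicator) (simp only: sets_vec_measure)
  finally show "emeasure (vec_measure E (E \<tau> h)) \<sigma> = emeasure (density (vec_measure E h) (indicator \<tau>)) \<sigma>"
    using s assms i by (simp add: emeasure_vec_measure E_Int)
qed (simp add: sets_vec_measure)

lemma nn_integral_vec_measure_E:
  assumes "\<tau> \<in> sets borel_Rplus" "f \<in> borel_measurable borel"
  shows "(\<integral>\<^sup>+ t. f t \<partial>vec_measure E (E \<tau> h)) = (\<integral>\<^sup>+ t. indicator \<tau> t * f t \<partial>vec_measure E h)"
  unfolding vec_measure_E[OF assms(1)]
  using assms(1) measurable_vec_measure[OF assms(2)]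
  by (intro nn_integral_density borel_measurable_indicator) (simp_all only: sets_vec_measure)

text \<open>The complements of the intervals decrease to the empty set, so continuity from above of
  the finite measure of \<open>h\<close> applies.\<close>

lemma E_cutoff_tendsto: "(\<lambda>n. E {0..real n} h) \<longlonglongrightarrow> h"
proof -
  define S where "S n = {0..} - {0..real n}" for n
  have S: "S n \<in> sets borel_Rplus" for n
    unfolding S_def by (auto simp: sets_borel_Rplus)
  have emp: "(\<Inter>n. S n) = {}"
    unfolding S_def using real_arch_simple by fastforce
  have "(\<lambda>n. emeasure (vec_measure E h) (S n)) \<longlonglongrightarrow> emeasure (vec_measure E h) (\<Inter>n. S n)"
    using S by (intro Lim_emeasure_decseq)
      (auto simp: sets_vec_measure emeasure_vec_measure decseq_def S_def)
  then have "(\<lambda>n. ennreal ((norm (E (S n) h))\<^sup>2)) \<longlonglongrightarrow> ennreal 0"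
    by (simp add: emp emeasure_vec_measure S)
  then have "(\<lambda>n. (norm (E (S n) h))\<^sup>2) \<longlonglongrightarrow> 0"
    by (subst (asm) tendsto_ennreal_iff) auto
  then have "(\<lambda>n. sqrt ((norm (E (S n) h))\<^sup>2)) \<longlonglongrightarrow> sqrt 0"
    by (rule tendsto_real_sqrt)
  moreover have "E (S n) h = h - E {0..real n} h" for n
    unfolding S_def by (rule E_Diff) (auto simp: sets_borel_Rplus)
  ultimately have "(\<lambda>n. norm (E {0..real n} h - h)) \<longlonglongrightarrow> 0"
    by (simp add: norm_minus_commute)
  then show ?thesis
    by (rule LIM_zero_cancel[OF tendsto_norm_zero_cancel])
qed

end

section \<open>Selfadjoint operators and their spectral measures\<close>

locale spectral_oper = spectral_family E for E :: "real set \<Rightarrow> 'a::chilbert_space \<Rightarrow> 'a" +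
  fixes B :: "'a oper"
  assumes selfadjoint: "selfadjoint_oper B"
    and spectral_of: "is_spectral_measure_of B E"
begin

lemma B_lin: "lin_oper B" and B_dense: "densely_defined B" and B_adjoint: "adjoint_oper B = B"
  using selfadjoint unfolding selfadjoint_oper_def by auto

lemmas B_add = lin_oper_add[OF B_lin]
lemmas B_diff = lin_oper_diff[OF B_lin]
lemmas B_scaleR = lin_oper_scaleR[OF B_lin]

lemma B_sym:
  assumes "f \<in> dom B" "g \<in> dom B"
  shows "inner (ap B f) g = inner f (ap B g)"
  using adjoint_oper_inner[OF B_dense, of g "ap B g" f] assms by (auto simp: B_adjoint)

text \<open>Adjoints are closed: the identity \<open>inner (ap B f) x = inner f y\<close>, which
  puts \<open>(x, y)\<close> in the graph of the adjoint, survives limits.\<close>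

lemma B_closed: "closed_oper B"
  unfolding closed_oper_def closed_sequential_limits
proof (intro allI impI)
  fix x l assume x: "(\<forall>n. x n \<in> Map.graph B) \<and> x \<longlonglongrightarrow> l"
  have "inner (ap B f) (fst l) = inner f (snd l)" if f: "f \<in> dom B" for f
  proof (rule LIMSEQ_unique)
    show "(\<lambda>n. inner (ap B f) (fst (x n))) \<longlonglongrightarrow> inner (ap B f) (fst l)"
      using x by (intro tendsto_intros) auto
    have "B (fst (x n)) = Some (snd (x n))" for n
      using x by (metis in_graphD prod.collapse)
    then have "inner (ap B f) (fst (x n)) = inner f (snd (x n))" for n
      using B_sym[OF f, of "fst (x n)"] by (simp add: dom_def)
    then show "(\<lambda>n. inner (ap B f) (fst (x n))) \<longlonglongrightarrow> inner f (snd l)"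
      using x by (auto intro!: tendsto_intros)
  qed
  then have "B (fst l) = Some (snd l)"
    using adjoint_oper_SomeI[OF B_dense cinner_eqI[OF B_lin]] by (simp add: B_adjoint)
  then show "l \<in> Map.graph B"
    using in_graphI[of B "fst l" "snd l"] by simp
qed

section \<open>The quadratic form of \<open>B\<close> and commutation with \<open>E\<close>\<close>

lemma dom_B: "f \<in> dom B \<longleftrightarrow> (\<integral>\<^sup>+ t. ennreal (t\<^sup>2) \<partial>vec_measure E f) < \<infinity>"
  using spectral_of unfolding is_spectral_measure_of_def by blast

text \<open>The measure lives on the half-line, so the integrand is nonnegative there and the
  integral can be handled by monotonicity and additivity of nonnegative integrals.\<close>

lemma B_form:
  assumes "f \<in> dom B"
  shows "inner (ap B f) f = enn2real (\<integral>\<^sup>+ t. ennreal t \<partial>vec_measure E f)"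
proof -
  have "cinner (ap B f) f = complex_of_real (\<integral>t. t \<partial>vec_measure E f)"
    using spectral_of assms unfolding is_spectral_measure_of_def by blast
  then have "inner (ap B f) f = (\<integral>t. t \<partial>vec_measure E f)"
    by (simp add: inner_eq_Re_cinner)
  also have "\<dots> = enn2real (\<integral>\<^sup>+ t. ennreal t \<partial>vec_measure E f)"
    by (intro integral_eq_nn_integral measurable_vec_measure AE_I2) auto
  finally show ?thesis .
qed

lemma B_pos: "f \<in> dom B \<Longrightarrow> 0 \<le> inner (ap B f) f"
  by (simp add: B_form)

lemma emeasure_space_vec_measure: "emeasure (vec_measure E f) {0..} = ennreal ((norm f)\<^sup>2)"
  by (subst emeasure_vec_measure) (auto simp: sets_borel_Rplus E_top)

text \<open>Finite total mass and \<open>t \<le> 1 + t\<^sup>2\<close> bound the first moment by the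
  second. Finiteness matters because \<open>enn2real\<close> sends infinity to 0.\<close>

lemma B_form_finite:
  assumes "f \<in> dom B"
  shows "(\<integral>\<^sup>+ t. ennreal t \<partial>vec_measure E f) < \<infinity>"
proof -
  have "(\<integral>\<^sup>+ t. ennreal t \<partial>vec_measure E f) \<le> (\<integral>\<^sup>+ t. 1 + ennreal (t\<^sup>2) \<partial>vec_measure E f)"
  proof (rule nn_integral_mono)
    fix t :: real
    have "t \<le> 1 + t\<^sup>2"
      using zero_le_power2[of "t - 1"] zero_le_power2[of t] unfolding power2_diff power_one by linarith
    then show "ennreal t \<le> 1 + ennreal (t\<^sup>2)"
      by (metis ennreal_1 ennreal_leI ennreal_plus zero_le_one zero_le_power2)
  qed
  also have "\<dots> = ennreal ((norm f)\<^sup>2) + (\<integral>\<^sup>+ t. ennreal (t\<^sup>2) \<partial>vec_measure E f)"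
    by (subst nn_integral_add) (auto intro!: measurable_vec_measure simp: emeasure_space_vec_measure)
  also have "\<dots> < \<infinity>"
    using assms dom_B by simp
  finally show ?thesis .
qed

lemma E_dom:
  assumes "\<tau> \<in> sets borel_Rplus" "f \<in> dom B"
  shows "E \<tau> f \<in> dom B"
proof -
  have "(\<integral>\<^sup>+ t. ennreal (t\<^sup>2) \<partial>vec_measure E (E \<tau> f)) = (\<integral>\<^sup>+ t. indicator \<tau> t * ennreal (t\<^sup>2) \<partial>vec_measure E f)"
    using assms by (intro nn_integral_vec_measure_E) auto
  also have "\<dots> \<le> (\<integral>\<^sup>+ t. ennreal (t\<^sup>2) \<partial>vec_measure E f)"
    by (intro nn_integral_mono) (simp split: split_indicator)
  also have "\<dots> < \<infinity>"
    using assms dom_B by simp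
  finally show ?thesis by (simp add: dom_B)
qed

text \<open>The form is an integral over the half-line, hence the sum of the integrals over
  \<open>\<tau>\<close> and over its complement.\<close>

lemma B_form_split:
  assumes \<tau>: "\<tau> \<in> sets borel_Rplus" and f: "f \<in> dom B"
  shows "inner (ap B (E \<tau> f)) (E \<tau> f) + inner (ap B (E ({0..} - \<tau>) f)) (E ({0..} - \<tau>) f) = inner (ap B f) f"
proof -
  note \<tau>' = E_Diff(2)[OF \<tau>]
  let ?I = "\<lambda>g. \<integral>\<^sup>+ t. ennreal t \<partial>vec_measure E g"
  have m: "(\<lambda>t. indicator \<sigma> t * ennreal t) \<in> borel_measurable (vec_measure E f)"
    if "\<sigma> \<in> sets borel_Rplus" for \<sigma>
    using that by (intro measurable_vec_measure borel_measurable_times borel_measurable_indicator)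
      (auto simp: sets_borel_Rplus)
  have "?I (E \<tau> f) + ?I (E ({0..} - \<tau>) f) =
      (\<integral>\<^sup>+ t. indicator \<tau> t * ennreal t \<partial>vec_measure E f) +
      (\<integral>\<^sup>+ t. indicator ({0..} - \<tau>) t * ennreal t \<partial>vec_measure E f)"
    by (subst (1 2) nn_integral_vec_measure_E) (use \<tau> \<tau>' in auto)
  also have "\<dots> = (\<integral>\<^sup>+ t. indicator \<tau> t * ennreal t + indicator ({0..} - \<tau>) t * ennreal t \<partial>vec_measure E f)"
    using m[OF \<tau>] m[OF \<tau>'] by (rule nn_integral_add[symmetric])
  also have "\<dots> = ?I f"
    by (intro nn_integral_cong) (auto split: split_indicator)
  finally have "enn2real (?I (E \<tau> f) + ?I (E ({0..} - \<tau>) f)) = enn2real (?I f)"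
    by simp
  then show ?thesis
    using B_form_finite E_dom[OF \<tau> f] E_dom[OF \<tau>' f] f
    by (simp add: B_form enn2real_plus)
qed

text \<open>Expanding the form at \<open>u + v\<close> produces the cross term
  \<open>2 * inner (ap B u) v\<close>; \<open>B_form_split\<close> at the same vector has
  none.\<close>

lemma B_cross_zero:
  assumes \<tau>: "\<tau> \<in> sets borel_Rplus" and f: "f \<in> dom B" and g: "g \<in> dom B"
  shows "inner (ap B (E \<tau> f)) (E ({0..} - \<tau>) g) = 0"
proof -
  note \<tau>' = E_Diff(2)[OF \<tau>]
  define u v where "u = E \<tau> f" and "v = E ({0..} - \<tau>) g"
  have uv: "u \<in> dom B" "v \<in> dom B"
    unfolding u_def v_def using E_dom \<tau> \<tau>' f g by auto
  have "E \<tau> (u + v) = u" "E ({0..} - \<tau>) (u + v) = v"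
    unfolding u_def v_def using E_disjoint[OF \<tau> \<tau>', of g] E_disjoint[OF \<tau>' \<tau>, of f]
    by (simp_all add: E_add[OF \<tau>] E_add[OF \<tau>'] E_idem[OF \<tau>] E_idem[OF \<tau>'] Int_commute)
  then have "inner (ap B u) u + inner (ap B v) v = inner (ap B (u + v)) (u + v)"
    using B_form_split[OF \<tau> B_add(1)[OF uv]] by simp
  also have "\<dots> = inner (ap B u) u + inner (ap B v) v + 2 * inner (ap B u) v"
    using B_sym[OF uv(2,1)] by (simp add: B_add[OF uv] inner_add_left inner_add_right inner_commute)
  finally show ?thesis
    unfolding u_def v_def by simp
qed

lemma E_B_compl_zero:
  assumes \<tau>: "\<tau> \<in> sets borel_Rplus" and f: "f \<in> dom B"
  shows "E ({0..} - \<tau>) (ap B (E \<tau> f)) = 0"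
proof (rule dense_orthogonal_zero[OF B_dense])
  fix g assume "g \<in> dom B"
  have "inner (E ({0..} - \<tau>) (ap B (E \<tau> f))) g = inner (ap B (E \<tau> f)) (E ({0..} - \<tau>) g)"
    by (rule E_sym[OF E_Diff(2)[OF \<tau>]])
  also have "\<dots> = 0"
    by (rule B_cross_zero[OF \<tau> f \<open>g \<in> dom B\<close>])
  finally show "inner g (E ({0..} - \<tau>) (ap B (E \<tau> f))) = 0"
    by (subst inner_commute)
qed

text \<open>\<open>B\<close> maps the parts of \<open>f\<close> in the ranges of
  \<open>E \<tau>\<close> and of the complementary projection into those same ranges, so applying
  \<open>E \<tau>\<close> to \<open>ap B f\<close> keeps exactly the first contribution.\<close>

lemma E_B_commute:
  assumes \<tau>: "\<tau> \<in> sets borel_Rplus" and f: "f \<in> dom B"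
  shows "ap B (E \<tau> f) = E \<tau> (ap B f)"
proof -
  note \<tau>' = E_Diff(2)[OF \<tau>]
  have "{0..} - ({0..} - \<tau>) = \<tau>"
    using \<tau> by (auto simp: sets_borel_Rplus)
  then have "E \<tau> (ap B (E ({0..} - \<tau>) f)) = 0"
    using E_B_compl_zero[OF \<tau>' f] by (simp only:)
  moreover have "ap B (E ({0..} - \<tau>) f) = ap B f - ap B (E \<tau> f)"
    using B_diff(2)[OF f E_dom[OF \<tau> f]] by (simp only: E_Diff(1)[OF \<tau>])
  ultimately have "E \<tau> (ap B f) = E \<tau> (ap B (E \<tau> f))"
    by (simp add: E_diff[OF \<tau>])
  also have "\<dots> = ap B (E \<tau> f)"
    using E_B_compl_zero[OF \<tau> f] E_Diff(1)[OF \<tau>, of "ap B (E \<tau> f)"] by simp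
  finally show ?thesis by simp
qed

section \<open>Bounds for \<open>B\<close> on cut-offs and on tails\<close>

lemma cutoff_sets: "{0..a} \<in> sets borel_Rplus" "b \<ge> 0 \<Longrightarrow> {b<..} \<in> sets borel_Rplus"
  by (auto simp: sets_borel_Rplus)

lemma cutoff_dom: "E {0..a} f \<in> dom B"
proof -
  have "(\<integral>\<^sup>+ t. ennreal (t\<^sup>2) \<partial>vec_measure E (E {0..a} f)) =
      (\<integral>\<^sup>+ t. indicator {0..a} t * ennreal (t\<^sup>2) \<partial>vec_measure E f)"
    by (intro nn_integral_vec_measure_E cutoff_sets) auto
  also have "\<dots> \<le> (\<integral>\<^sup>+ t. ennreal (a\<^sup>2) \<partial>vec_measure E f)"
    by (intro nn_integral_mono) (auto split: split_indicator intro!: ennreal_leI power_mono)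
  also have "\<dots> < \<infinity>"
    by (simp add: emeasure_space_vec_measure ennreal_mult_less_top)
  finally show ?thesis by (simp add: dom_B)
qed

lemma cutoff_B: "E {0..a} (ap B (E {0..a} f)) = ap B (E {0..a} f)"
  using E_B_commute[OF cutoff_sets(1) cutoff_dom, of a a f] by (simp add: E_idem[OF cutoff_sets(1)])

lemma cutoff_form_le:
  assumes "0 \<le> a"
  shows "inner (ap B (E {0..a} f)) (E {0..a} f) \<le> a * (norm (E {0..a} f))\<^sup>2"
proof -
  let ?f = "E {0..a} f"
  \<comment> \<open>The cut-off vector is written as its own projection, which confines the integral
    to \<open>{0..a}\<close>.\<close>
  have "(\<integral>\<^sup>+ t. ennreal t \<partial>vec_measure E ?f) = (\<integral>\<^sup>+ t. ennreal t \<partial>vec_measure E (E {0..a} ?f))"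
    by (simp add: E_idem[OF cutoff_sets(1)])
  also have "\<dots> = (\<integral>\<^sup>+ t. indicator {0..a} t * ennreal t \<partial>vec_measure E ?f)"
    by (intro nn_integral_vec_measure_E cutoff_sets) auto
  also have "\<dots> \<le> (\<integral>\<^sup>+ t. ennreal a \<partial>vec_measure E ?f)"
    by (intro nn_integral_mono) (auto split: split_indicator intro!: ennreal_leI)
  also have "\<dots> = ennreal (a * (norm ?f)\<^sup>2)"
    using assms by (simp add: emeasure_space_vec_measure ennreal_mult)
  finally have "enn2real (\<integral>\<^sup>+ t. ennreal t \<partial>vec_measure E ?f) \<le> a * (norm ?f)\<^sup>2"
    using assms by (intro enn2real_leI) auto
  then show ?thesis by (simp add: B_form[OF cutoff_dom])
qed

text \<open>From \<open>0 \<le> B \<le> a\<close> on the range of \<open>E {0..a}\<close>: evaluate the form at \<open>g - B g / a\<close>.\<close>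

lemma cutoff_norm_le:
  assumes "0 < a"
  shows "norm (ap B (E {0..a} f)) \<le> a * norm (E {0..a} f)"
proof -
  define g where "g = E {0..a} f"
  have g: "g \<in> dom B" unfolding g_def by (rule cutoff_dom)
  have Bg: "ap B g \<in> dom B" using cutoff_B[of a f] cutoff_dom[of a "ap B g"] unfolding g_def by simp
  have le: "inner (ap B g) g \<le> a * (norm g)\<^sup>2"
    "inner (ap B (ap B g)) (ap B g) \<le> a * (norm (ap B g))\<^sup>2"
    using cutoff_form_le[of a f] cutoff_form_le[of a "ap B g"] assms cutoff_B[of a f]
    unfolding g_def by auto
  define c where "c = 1 / a"
  let ?h = "g - c *\<^sub>R ap B g"
  have h: "?h \<in> dom B" "ap B ?h = ap B g - c *\<^sub>R ap B (ap B g)"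
    by (simp_all add: B_diff[OF g B_scaleR(1)[OF Bg]] B_scaleR[OF Bg])
  have "0 \<le> inner (ap B ?h) ?h"
    by (rule B_pos[OF h(1)])
  also have "\<dots> = inner (ap B g) g - 2 * c * inner (ap B g) (ap B g) + c\<^sup>2 * inner (ap B (ap B g)) (ap B g)"
    using B_sym[OF Bg g] unfolding h(2)
    by (simp add: inner_diff_left inner_diff_right power2_eq_square algebra_simps)
  also have "\<dots> = inner (ap B g) g - 2 * (1 / a) * (norm (ap B g))\<^sup>2 + (1 / a)\<^sup>2 * inner (ap B (ap B g)) (ap B g)"
    by (simp add: c_def dot_square_norm)
  also have "\<dots> \<le> a * (norm g)\<^sup>2 - 2 * (1 / a) * (norm (ap B g))\<^sup>2 + (1 / a)\<^sup>2 * (a * (norm (ap B g))\<^sup>2)"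
    using le assms by (intro add_mono diff_mono mult_left_mono) auto
  also have "\<dots> = a * (norm g)\<^sup>2 - (norm (ap B g))\<^sup>2 / a"
    using assms by (simp add: power2_eq_square field_simps)
  finally have "(norm (ap B g))\<^sup>2 \<le> (a * norm g)\<^sup>2"
    using assms by (simp add: power2_eq_square field_simps)
  then show ?thesis
    unfolding g_def by (rule power2_le_imp_le) (use assms in simp)
qed

text \<open>On the tail the integrand exceeds \<open>b\<close>, so the form is at least
  \<open>b * (norm ?f)\<^sup>2\<close>; Cauchy-Schwarz then lets one factor \<open>norm ?f\<close>
  cancel.\<close>

lemma tail_norm_ge:
  assumes b: "0 \<le> b" and f: "f \<in> dom B"
  shows "b * norm (E {b<..} f) \<le> norm (ap B (E {b<..} f))"
proof -
  note s = cutoff_sets(2)[OF b]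
  let ?f = "E {b<..} f"
  have d: "?f \<in> dom B" using E_dom[OF s f] .
  have "ennreal (b * (norm ?f)\<^sup>2) = (\<integral>\<^sup>+ t. ennreal b * indicator {b<..} t \<partial>vec_measure E ?f)"
    using s by (subst nn_integral_cmult_indicator)
      (auto simp: sets_vec_measure emeasure_vec_measure E_idem ennreal_mult b)
  also have "\<dots> \<le> (\<integral>\<^sup>+ t. ennreal t \<partial>vec_measure E ?f)"
    by (intro nn_integral_mono) (auto split: split_indicator intro!: ennreal_leI)
  finally have "enn2real (ennreal (b * (norm ?f)\<^sup>2)) \<le> inner (ap B ?f) ?f"
    unfolding B_form[OF d] using B_form_finite[OF d] by (intro enn2real_mono) auto
  then have "b * (norm ?f)\<^sup>2 \<le> inner (ap B ?f) ?f"
    using b by simp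
  also have "\<dots> \<le> norm (ap B ?f) * norm ?f"
    by (rule norm_cauchy_schwarz)
  finally show ?thesis
    by (cases "norm ?f = 0") (auto simp: power2_eq_square)
qed

end

section \<open>The domain of the modulus\<close>

lemma map_comp_SomeI:
  "f \<in> dom A \<Longrightarrow> ap A f \<in> dom B \<Longrightarrow> (B \<circ>\<^sub>m A) f = Some (ap B (ap A f))"
  by (auto simp: map_comp_def)

lemma map_comp_SomeD:
  assumes "(B \<circ>\<^sub>m A) f = Some h"
  shows "f \<in> dom A" "ap A f \<in> dom B" "ap B (ap A f) = h" "B (ap A f) = Some h"
  using assms by (auto simp: map_comp_def split: option.splits)

context spectral_oper
begin

text \<open>The range of \<open>E {0..a}\<close> lies in the domain and is invariant under
  \<open>B\<close>, so \<open>B\<close> can be iterated on it.\<close>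

lemma cutoff_B_dom: "ap B (E {0..a} f) \<in> dom B"
  using cutoff_dom[of a "ap B (E {0..a} f)"] by (simp only: cutoff_B)

lemma cutoff_BB: "E {0..a} (ap B (ap B (E {0..a} f))) = ap B (ap B (E {0..a} f))"
  using cutoff_B[of a "ap B (E {0..a} f)"] by (simp only: cutoff_B)

end

locale modulus_oper =
  fixes A B :: "'a::chilbert_space oper" and E :: "real set \<Rightarrow> 'a \<Rightarrow> 'a"
  assumes A_lin: "lin_oper A" and A_closed: "closed_oper A" and A_dense: "densely_defined A"
    and modulus: "is_modulus A B"
    and spectral_modulus: "is_spectral_measure_of B E"
begin

sublocale spectral_oper E B
  using modulus spectral_modulus
  by unfold_locales (auto simp: is_modulus_def is_spectral_measure_of_def)

text \<open>The equality of \<open>B \<circ>\<^sub>m B\<close> with the adjoint product includes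
  domains, which gives the first claim; the second is the defining relation of the adjoint.\<close>

lemma square_inner:
  assumes "f \<in> dom B" "ap B f \<in> dom B"
  shows "f \<in> dom A"
    and "g \<in> dom A \<Longrightarrow> inner (ap A f) (ap A g) = inner (ap B (ap B f)) g"
proof -
  have "B \<circ>\<^sub>m B = adjoint_oper A \<circ>\<^sub>m A"
    using modulus unfolding is_modulus_def by blast
  then have *: "(adjoint_oper A \<circ>\<^sub>m A) f = Some (ap B (ap B f))"
    using map_comp_SomeI[OF assms] by (simp only:)
  show "f \<in> dom A"
    by (rule map_comp_SomeD(1)[OF *])
  assume "g \<in> dom A"
  from adjoint_oper_inner[OF A_dense map_comp_SomeD(4)[OF *] this]
  show "inner (ap A f) (ap A g) = inner (ap B (ap B f)) g"
    by (simp only: inner_commute)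
qed

lemma square_norm:
  assumes "f \<in> dom B" "ap B f \<in> dom B"
  shows "norm (ap A f) = norm (ap B f)"
  unfolding norm_eq_sqrt_inner square_inner(2)[OF assms square_inner(1)[OF assms]]
    B_sym[OF assms(2,1)] ..

text \<open>The images \<open>ap B (c n)\<close> are projections of \<open>ap B f\<close> and
  converge. By \<open>square_norm\<close> the vectors \<open>ap A (c n)\<close> have the same mutual
  distances, so they converge too and closedness of \<open>A\<close> applies.\<close>

lemma dom_modulus_subset: "dom B \<subseteq> dom A"
proof
  fix f assume f: "f \<in> dom B"
  define c where "c n = E {0..real n} f" for n
  have c: "c n \<in> dom B" "ap B (c n) \<in> dom B" "c n \<in> dom A" for n
    unfolding c_def using square_inner(1)[OF cutoff_dom cutoff_B_dom] cutoff_dom cutoff_B_dom by blast+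
  have "ap B (c n) = E {0..real n} (ap B f)" for n
    unfolding c_def using E_B_commute[OF cutoff_sets(1) f] .
  then have "(\<lambda>n. ap B (c n)) \<longlonglongrightarrow> ap B f"
    using E_cutoff_tendsto by simp
  then have "Cauchy (\<lambda>n. ap B (c n))"
    by (rule LIMSEQ_imp_Cauchy)
  moreover have "dist (ap A (c m)) (ap A (c n)) = dist (ap B (c m)) (ap B (c n))" for m n
    using square_norm[of "c m - c n"] B_diff[OF c(1) c(1)] B_diff(1)[OF c(2) c(2)]
      lin_oper_diff(2)[OF A_lin c(3) c(3)]
    by (simp add: dist_norm)
  ultimately have "Cauchy (\<lambda>n. ap A (c n))"
    by (simp add: Cauchy_def)
  then obtain k where "(\<lambda>n. ap A (c n)) \<longlonglongrightarrow> k"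
    using Cauchy_convergent convergentD by blast
  moreover have "c \<longlonglongrightarrow> f"
    unfolding c_def by (rule E_cutoff_tendsto)
  ultimately have "A f = Some k"
    using closed_operD[of A c f k] A_closed c(3) by blast
  then show "f \<in> dom A" by (rule domI)
qed

text \<open>For \<open>f\<close> in the domain of \<open>A\<close>, the cut-offs \<open>c n = E {0..n} f\<close> satisfy
  \<open>\<parallel>B (c n)\<parallel>\<^sup>2 = \<langle>A\<^sup>* A (c n), f\<rangle> = \<langle>A (c n), A f\<rangle>\<close>, so that \<open>\<parallel>B (c n)\<parallel> \<le> \<parallel>A f\<parallel>\<close>; being
  increasing, these norms converge, which makes \<open>B (c n)\<close> a Cauchy sequence.\<close>

lemma dom_subset_modulus: "dom A \<subseteq> dom B"
proof
  fix f assume f: "f \<in> dom A"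
  define c where "c n = E {0..real n} f" for n
  have c: "c n \<in> dom B" "ap B (c n) \<in> dom B" "c n \<in> dom A" for n
    unfolding c_def using square_inner(1)[OF cutoff_dom cutoff_B_dom] cutoff_dom cutoff_B_dom by blast+
  define N where "N n = (norm (ap B (c n)))\<^sup>2" for n
  have le: "norm (ap B (c n)) \<le> norm (ap A f)" for n
  proof -
    have "(norm (ap B (c n)))\<^sup>2 = inner (ap B (ap B (c n))) (c n)"
      using B_sym[OF c(2,1)] by (simp add: dot_square_norm)
    also have "\<dots> = inner (E {0..real n} (ap B (ap B (c n)))) f"
      unfolding c_def E_sym[OF cutoff_sets(1)] ..
    also have "\<dots> = inner (ap B (ap B (c n))) f"
      unfolding c_def cutoff_BB ..
    also have "\<dots> = inner (ap A (c n)) (ap A f)"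
      using square_inner(2)[OF c(1,2) f] by (rule sym)
    also have "\<dots> \<le> norm (ap A (c n)) * norm (ap A f)"
      by (rule norm_cauchy_schwarz)
    finally show ?thesis
      unfolding square_norm[OF c(1,2)]
      by (cases "norm (ap B (c n)) = 0") (auto simp: power2_eq_square)
  qed
  \<comment> \<open>Pythagoras: \<open>ap B (c m)\<close> is the projection of
    \<open>ap B (c n)\<close>, so squared distances are increments of \<open>N\<close>. Hence
    \<open>N\<close> increases, and its convergence forces the Cauchy property.\<close>
  have split: "N m + (dist (ap B (c m)) (ap B (c n)))\<^sup>2 = N n" if "m \<le> n" for m n
  proof -
    have "{0..real m} \<inter> {0..real n} = {0..real m}"
      using that by auto
    then have "E {0..real m} (c n) = c m"
      unfolding c_def by (simp add: E_Int cutoff_sets)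
    then have "E {0..real m} (ap B (c n)) = ap B (c m)"
      using E_B_commute[OF cutoff_sets(1)[of "real m"] c(1)[of n]] by simp
    then show ?thesis
      using norm_E_split[OF cutoff_sets(1), of "real m" "ap B (c n)"]
      by (simp add: N_def dist_norm norm_minus_commute)
  qed
  have "incseq N"
  proof (rule incseq_SucI)
    show "N n \<le> N (Suc n)" for n
      using split[of n "Suc n"] zero_le_power2[of "dist (ap B (c n)) (ap B (c (Suc n)))"] by linarith
  qed
  moreover have "N n \<le> (norm (ap A f))\<^sup>2" for n
    unfolding N_def by (intro power_mono le) simp
  ultimately obtain L where "N \<longlonglongrightarrow> L"
    using incseq_convergent by blast
  then have N: "Cauchy N"
    by (rule LIMSEQ_imp_Cauchy)
  have dist: "(dist (ap B (c m)) (ap B (c n)))\<^sup>2 = dist (N m) (N n)" for m n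
  proof (cases "m \<le> n")
    case True
    then show ?thesis
      using split[OF True] zero_le_power2[of "dist (ap B (c m)) (ap B (c n))"]
      unfolding dist_real_def by linarith
  next
    case False
    then show ?thesis
      using split[of n m] zero_le_power2[of "dist (ap B (c n)) (ap B (c m))"]
      unfolding dist_real_def dist_commute[of "ap B (c m)"] by linarith
  qed
  have "Cauchy (\<lambda>n. ap B (c n))"
    unfolding Cauchy_def
  proof (intro allI impI)
    fix e :: real assume e: "e > 0"
    then obtain M where "\<And>m n. m \<ge> M \<Longrightarrow> n \<ge> M \<Longrightarrow> dist (N m) (N n) < e\<^sup>2"
      using N unfolding Cauchy_def by (metis zero_less_power)
    then have "dist (ap B (c m)) (ap B (c n)) < e" if "m \<ge> M" "n \<ge> M" for m n
      using that e dist[of m n] by (intro power_less_imp_less_base[of _ 2 e]) auto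
    then show "\<exists>M. \<forall>m\<ge>M. \<forall>n\<ge>M. dist (ap B (c m)) (ap B (c n)) < e"
      by blast
  qed
  then obtain k where "(\<lambda>n. ap B (c n)) \<longlonglongrightarrow> k"
    using Cauchy_convergent convergentD by blast
  moreover have "c \<longlonglongrightarrow> f"
    unfolding c_def by (rule E_cutoff_tendsto)
  ultimately have "B f = Some k"
    using closed_operD[of B c f k] B_closed c(1) by blast
  then show "f \<in> dom B" by (rule domI)
qed

lemma dom_modulus: "dom B = dom A"
  using dom_modulus_subset dom_subset_modulus by blast

end

section \<open>Uniqueness of the modulus and of its spectral measure\<close>

text \<open>\<open>B\<^sup>2\<close> maps the range of \<open>E {0..a}\<close> into itself with norm at most \<open>a\<^sup>2\<close>, and is bounded
  below by \<open>b\<^sup>2\<close> on the range of \<open>E' {b<..}\<close>, with which it commutes. So \<open>E' {b<..} E {0..a}\<close> is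
  bounded by \<open>(a\<^sup>2 / b\<^sup>2)\<^sup>n\<close> for every \<open>n\<close>.\<close>

lemma tail_cutoff_zero:
  assumes "spectral_oper E B" "spectral_oper E' B'" and sq: "B \<circ>\<^sub>m B = B' \<circ>\<^sub>m B'"
    and ab: "0 < a" "a < b"
  shows "E' {b<..} (E {0..a} f) = (0::'a::chilbert_space)"
proof -
  interpret b: spectral_oper E B by fact
  interpret b': spectral_oper E' B' by fact
  have b: "0 \<le> b" using ab by simp
  note s' = b'.cutoff_sets(2)[OF b]
  define q where "q = a\<^sup>2 / b\<^sup>2"
  have q: "0 \<le> q" "q < 1"
    using ab by (auto simp: q_def power_strict_mono)
  \<comment> \<open>The vector stays arbitrary because the induction hypothesis is applied to
    \<open>v\<close>, the image of \<open>u\<close> under the square of \<open>B\<close>, which is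
    again fixed by \<open>E {0..a}\<close>.\<close>
  have iter: "norm (E' {b<..} (E {0..a} f)) \<le> q ^ n * norm (E {0..a} f)" for n f
  proof (induction n arbitrary: f)
    case 0
    show ?case using b'.E_norm_le[OF s'] by simp
  next
    case (Suc n)
    define u where "u = E {0..a} f"
    define v where "v = ap B (ap B u)"
    define w where "w = E' {b<..} u"
    have "(B \<circ>\<^sub>m B) u = Some v"
      unfolding u_def v_def by (rule map_comp_SomeI[OF b.cutoff_dom b.cutoff_B_dom])
    then have u: "u \<in> dom B'" "ap B' u \<in> dom B'" "ap B' (ap B' u) = v"
      unfolding sq by (rule map_comp_SomeD)+
    have w: "ap B' w = E' {b<..} (ap B' u)" "ap B' (ap B' w) = E' {b<..} v"
      unfolding w_def b'.E_B_commute[OF s' u(1)] b'.E_B_commute[OF s' u(2)] u(3) by (rule refl)+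
    have v: "E {0..a} v = v"
      unfolding v_def u_def by (rule b.cutoff_BB)
    have "norm v \<le> a * norm (ap B u)"
      using b.cutoff_norm_le[OF ab(1), of "ap B u"] unfolding v_def u_def b.cutoff_B .
    also have "\<dots> \<le> a * (a * norm u)"
      unfolding u_def using ab b.cutoff_norm_le[OF ab(1), of f] by (intro mult_left_mono) auto
    finally have nv: "norm v \<le> a\<^sup>2 * norm u"
      by (simp add: power2_eq_square)
    have "b * (b * norm w) \<le> b * norm (ap B' w)"
      unfolding w_def using b b'.tail_norm_ge[OF b u(1)] by (intro mult_left_mono) auto
    also have "\<dots> \<le> norm (E' {b<..} v)"
      using b'.tail_norm_ge[OF b u(2)] unfolding w(2)[symmetric] w(1) .
    also have "\<dots> \<le> q ^ n * norm v"
      using Suc.IH[of v] unfolding v .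
    also have "\<dots> \<le> q ^ n * (a\<^sup>2 * norm u)"
      using nv q by (intro mult_left_mono) auto
    finally have "norm w \<le> q ^ Suc n * norm u"
      using ab by (simp add: q_def power2_eq_square field_simps)
    then show ?case
      unfolding w_def u_def .
  qed
  have "(\<lambda>n. q ^ n * norm (E {0..a} f)) \<longlonglongrightarrow> 0"
    using q by (intro tendsto_mult_left_zero LIMSEQ_power_zero) auto
  then have "norm (E' {b<..} (E {0..a} f)) \<le> 0"
    using iter by (intro LIMSEQ_le_const) auto
  then show ?thesis by simp
qed

text \<open>\<open>tail_cutoff_zero\<close> needs a positive cut-off strictly below the tail; the
  midpoint of \<open>a\<close> and \<open>b\<close> qualifies even for \<open>a = 0\<close>.
  Countably many such null tails then exhaust \<open>{a<..}\<close>.\<close>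

lemma cutoff_absorb:
  assumes "spectral_oper E B" "spectral_oper E' B'" "B \<circ>\<^sub>m B = B' \<circ>\<^sub>m B'" and a: "0 \<le> a"
  shows "E' {0..a} (E {0..a} f) = (E {0..a} f :: 'a::chilbert_space)"
proof -
  interpret b: spectral_oper E B by fact
  interpret b': spectral_oper E' B' by fact
  let ?x = "E {0..a} f"
  have "{b<..} \<in> null_sets (vec_measure E' ?x)" if "a < b" for b
  proof -
    have c: "0 < (a + b) / 2" "(a + b) / 2 < b" "{0..(a + b) / 2} \<inter> {0..a} = {0..a}"
      using a that by auto
    have "E {0..(a + b) / 2} ?x = ?x"
      unfolding b.E_Int[OF b.cutoff_sets(1) b.cutoff_sets(1)] c(3) ..
    then have "E' {b<..} ?x = 0"
      using tail_cutoff_zero[OF assms(1-3) c(1,2), of ?x] by simp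
    then show ?thesis
      using a that b'.cutoff_sets(2)[of b] by (simp add: b'.null_sets_vec_measure)
  qed
  then have "(\<Union>n. {a + inverse (real (Suc n))<..}) \<in> null_sets (vec_measure E' ?x)"
    by (intro null_sets_UN) auto
  also have "(\<Union>n. {a + inverse (real (Suc n))<..}) = {a<..}"
  proof -
    have "\<exists>n. a + inverse (real (Suc n)) < t" if "a < t" for t
      using reals_Archimedean[of "t - a"] that by (auto simp: algebra_simps)
    moreover have "a < t" if "a + inverse (real (Suc n)) < t" for t n
      using that positive_imp_inverse_positive[of "real (Suc n)"] by linarith
    ultimately show ?thesis by auto
  qed
  also have "{a<..} = {0..} - {0..a}"
    using a by auto
  finally have "E' ({0..} - {0..a}) ?x = 0"
    using b'.null_sets_vec_measure by blast
  then show ?thesis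
    unfolding b'.E_Diff(1)[OF b'.cutoff_sets(1)] by simp
qed

text \<open>Mutual absorption makes the projections agree on each \<open>{0..a}\<close>; the
  half-lines \<open>{..a}\<close> form an intersection-stable generator of the Borel sets. The
  induction runs over subsets of the whole line, hence the intersections with
  \<open>{0..}\<close>.\<close>

lemma spectral_measure_unique:
  fixes E E' :: "real set \<Rightarrow> 'a::chilbert_space \<Rightarrow> 'a"
  assumes "spectral_oper E B" "spectral_oper E' B'" "B \<circ>\<^sub>m B = B' \<circ>\<^sub>m B'"
    and "\<sigma> \<in> sets borel_Rplus"
  shows "E \<sigma> f = E' \<sigma> f"
proof -
  interpret b: spectral_oper E B by fact
  interpret b': spectral_oper E' B' by fact
  let ?G = "range (\<lambda>a::real. {..a})"
  have G: "sigma_sets UNIV ?G = sets borel"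
    by (subst borel_eq_atMost) simp
  have mem: "\<tau> \<inter> {0..} \<in> sets borel_Rplus" if "\<tau> \<in> sigma_sets UNIV ?G" for \<tau>
    using that unfolding G sets_borel_Rplus by auto
  have "Int_stable ?G"
    unfolding Int_stable_def by auto
  moreover have "?G \<subseteq> Pow UNIV"
    by simp
  moreover have "\<sigma> \<in> sigma_sets UNIV ?G"
    using assms(4) unfolding G sets_borel_Rplus by blast
  ultimately have "\<forall>f. E (\<sigma> \<inter> {0..}) f = E' (\<sigma> \<inter> {0..}) f"
  proof (induction \<sigma> rule: sigma_sets_induct_disjoint)
    case (basic \<tau>)
    then obtain a where \<tau>: "\<tau> = {..a}" by blast
    show ?case
    proof (cases "0 \<le> a")
      case True
      have "E {0..a} f = E' {0..a} f" for f
        by (rule orth_projection_eqI[OF b.proj[OF b.cutoff_sets(1)] b'.proj[OF b'.cutoff_sets(1)]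
              cutoff_absorb[OF assms(1-3) True] cutoff_absorb[OF assms(2,1) assms(3)[symmetric] True]])
      moreover have "\<tau> \<inter> {0..} = {0..a}"
        unfolding \<tau> by auto
      ultimately show ?thesis by (simp only: simp_thms)
    next
      case False
      then have "\<tau> \<inter> {0..} = {}"
        unfolding \<tau> by auto
      then show ?thesis by (simp only: b.E_empty b'.E_empty simp_thms)
    qed
  next
    case empty
    show ?case by (simp only: Int_empty_left b.E_empty b'.E_empty simp_thms)
  next
    case (compl \<tau>)
    have "(UNIV - \<tau>) \<inter> {0..} = {0..} - \<tau> \<inter> {0..}" by auto
    then show ?case
      using compl(2) by (simp only: b.E_Diff(1)[OF mem[OF compl(1)]] b'.E_Diff(1)[OF mem[OF compl(1)]] simp_thms)
  next
    case (union S)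
    have S: "range (\<lambda>n. S n \<inter> {0..}) \<subseteq> sets borel_Rplus" "disjoint_family (\<lambda>n. S n \<inter> {0..})"
      using union mem by (auto simp: disjoint_family_on_def)
    have "(\<lambda>n. E (S n \<inter> {0..}) f) sums E (\<Union>n. S n \<inter> {0..}) f" for f
      by (rule b.E_sums[OF S])
    moreover have "(\<lambda>n. E (S n \<inter> {0..}) f) sums E' (\<Union>n. S n \<inter> {0..}) f" for f
      using b'.E_sums[OF S] union by simp
    ultimately have "E (\<Union>n. S n \<inter> {0..}) f = E' (\<Union>n. S n \<inter> {0..}) f" for f
      by (rule sums_unique2)
    moreover have "(\<Union>n. S n) \<inter> {0..} = (\<Union>n. S n \<inter> {0..})"
      by auto
    ultimately show ?case by (simp only: simp_thms)
  qed
  moreover have "\<sigma> \<inter> {0..} = \<sigma>"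
    using assms(4) unfolding sets_borel_Rplus by blast
  ultimately show ?thesis by (simp only: simp_thms)
qed

text \<open>Equal spectral measures give equal domains and quadratic forms; polarization and density
  recover the operator.\<close>

lemma square_root_unique:
  fixes E E' :: "real set \<Rightarrow> 'a::chilbert_space \<Rightarrow> 'a"
  assumes "spectral_oper E B" "spectral_oper E' B'" "B \<circ>\<^sub>m B = B' \<circ>\<^sub>m B'"
  shows "B = B'"
proof
  fix f
  interpret b: spectral_oper E B by fact
  interpret b': spectral_oper E' B' by fact
  have vec: "vec_measure E f = vec_measure E' f" for f
    by (rule measure_eqI)
      (simp_all only: b.sets_vec_measure b'.sets_vec_measure b.emeasure_vec_measure
        b'.emeasure_vec_measure spectral_measure_unique[OF assms])
  have dom: "dom B = dom B'"
    by (rule set_eqI) (simp only: b.dom_B b'.dom_B vec)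
  have form: "inner (ap B f) f = inner (ap B' f) f" if "f \<in> dom B" for f
    using that b.B_form[of f] b'.B_form[of f] by (simp only: vec dom)
  have polar: "inner (ap B f) g = inner (ap B' f) g" if fg: "f \<in> dom B" "g \<in> dom B" for f g
    using form[OF b.B_add(1)[OF fg]] form[OF fg(1)] form[OF fg(2)] b.B_sym[OF fg] b'.B_sym[of f g]
      b.B_add(2)[OF fg] b'.B_add(2)[of f g] fg
    by (simp add: dom inner_add_left inner_add_right inner_commute)
  show "B f = B' f"
  proof (cases "f \<in> dom B")
    case True
    have "inner g (ap B f - ap B' f) = 0" if "g \<in> dom B" for g
      using polar[OF True that] by (simp add: inner_diff_right inner_commute)
    then have "ap B f - ap B' f = 0"
      by (rule dense_orthogonal_zero[OF b.B_dense])
    moreover have "f \<in> dom B'"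
      using True dom by simp
    ultimately show ?thesis
      using True by auto
  next
    case False
    then show ?thesis
      using dom by (metis domIff)
  qed
qed

section \<open>The intertwining map\<close>

lemma (in spectral_family) norm_E_split_Int:
  assumes s: "\<sigma> \<in> sets borel_Rplus" "\<tau> \<in> sets borel_Rplus" and x: "E \<tau> x = x"
  shows "(norm x)\<^sup>2 = (norm (E (\<tau> \<inter> \<sigma>) x))\<^sup>2 + (norm (E (\<tau> - \<sigma>) x))\<^sup>2"
proof -
  have "E \<sigma> x = E (\<tau> \<inter> \<sigma>) x"
    using E_Int[OF s, of x] unfolding x by (simp only: Int_commute)
  moreover have "({0..} - \<sigma>) \<inter> \<tau> = \<tau> - \<sigma>"
    using s(2) unfolding sets_borel_Rplus by blast
  then have "x - E \<sigma> x = E (\<tau> - \<sigma>) x"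
    using E_Int[OF E_Diff(2)[OF s(1)] s(2), of x] E_Diff(1)[OF s(1), of x] unfolding x by simp
  ultimately show ?thesis
    using norm_E_split[OF s(1), of x] by simp
qed

section \<open>Sums of projected vectors and their refinement\<close>

context spectral_family
begin

text \<open>A list encodes an element of the span \<open>H0\<close>, with scalars absorbed into the
  vectors \<open>f\<close>. Keeping \<open>F\<close> as a parameter allows the same list to be
  evaluated for \<open>A\<close> and for its modulus; \<open>\<tau>\<close> localizes the sum to one
  piece.\<close>

definition comb :: "'a oper \<Rightarrow> real set \<Rightarrow> (real set \<times> 'a) list \<Rightarrow> 'a" where
  "comb F \<tau> xs = (\<Sum>(\<sigma>, f)\<leftarrow>xs. E (\<tau> \<inter> \<sigma>) (ap F f))"

lemma comb_Nil [simp]: "comb F \<tau> [] = 0"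
  and comb_Cons [simp]: "comb F \<tau> ((\<sigma>, f) # xs) = E (\<tau> \<inter> \<sigma>) (ap F f) + comb F \<tau> xs"
  and comb_append: "comb F \<tau> (xs @ ys) = comb F \<tau> xs + comb F \<tau> ys"
  unfolding comb_def by simp_all

lemma E_comb:
  assumes "\<rho> \<in> sets borel_Rplus" "\<tau> \<in> sets borel_Rplus" "set xs \<subseteq> sets borel_Rplus \<times> D"
  shows "E \<rho> (comb F \<tau> xs) = comb F (\<rho> \<inter> \<tau>) xs"
  using assms(3)
proof (induction xs)
  case Nil
  show ?case using assms(1) by (simp add: E_zero)
next
  case (Cons x xs)
  obtain \<sigma> f where x: "x = (\<sigma>, f)" by (cases x)
  have "\<sigma> \<in> sets borel_Rplus" using Cons.prems x by simp
  then have "\<tau> \<inter> \<sigma> \<in> sets borel_Rplus" by (rule sets.Int[OF assms(2)])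
  then show ?case
    using Cons assms(1) unfolding x by (simp add: E_add E_Int Int_assoc)
qed

text \<open>On \<open>\<tau> \<inter> \<sigma>\<close> the new term merges with \<open>g\<close> by
  linearity of \<open>F\<close>, on \<open>\<tau> - \<sigma>\<close> it disappears, and the two
  pieces are orthogonal.\<close>

lemma comb_refine:
  assumes F: "lin_oper F" and f: "f \<in> dom F" and g: "g \<in> dom F"
    and \<sigma>: "\<sigma> \<in> sets borel_Rplus" and \<tau>: "\<tau> \<in> sets borel_Rplus"
    and xs: "set xs \<subseteq> sets borel_Rplus \<times> D"
  shows "(norm (E \<tau> (ap F g) + comb F \<tau> ((\<sigma>, f) # xs)))\<^sup>2 =
    (norm (E (\<tau> \<inter> \<sigma>) (ap F (g + f)) + comb F (\<tau> \<inter> \<sigma>) xs))\<^sup>2 +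
    (norm (E (\<tau> - \<sigma>) (ap F g) + comb F (\<tau> - \<sigma>) xs))\<^sup>2"
proof -
  let ?x = "E \<tau> (ap F g) + comb F \<tau> ((\<sigma>, f) # xs)"
  note s1 = sets.Int[OF \<tau> \<sigma>]
  note s2 = sets.Diff[OF \<tau> \<sigma>]
  have e: "E \<rho> ?x = E (\<rho> \<inter> \<tau>) (ap F g) + (E (\<rho> \<inter> (\<tau> \<inter> \<sigma>)) (ap F f) + comb F (\<rho> \<inter> \<tau>) xs)"
    if "\<rho> \<in> sets borel_Rplus" for \<rho>
    using that by (simp add: E_add E_Int E_comb[OF that \<tau> xs] \<tau> s1)
  have "\<tau> \<inter> \<sigma> \<inter> \<tau> = \<tau> \<inter> \<sigma>" "(\<tau> - \<sigma>) \<inter> \<tau> = \<tau> - \<sigma>" "(\<tau> - \<sigma>) \<inter> (\<tau> \<inter> \<sigma>) = {}"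
    by blast+
  then have "E (\<tau> \<inter> \<sigma>) ?x = E (\<tau> \<inter> \<sigma>) (ap F (g + f)) + comb F (\<tau> \<inter> \<sigma>) xs"
    and "E (\<tau> - \<sigma>) ?x = E (\<tau> - \<sigma>) (ap F g) + comb F (\<tau> - \<sigma>) xs"
    unfolding e[OF s1] e[OF s2] lin_oper_add(2)[OF F g f]
    by (simp_all add: E_empty E_add[OF s1] add.assoc)
  moreover have "E \<tau> ?x = ?x"
    using e[OF \<tau>] by simp
  ultimately show ?thesis
    using norm_E_split_Int[OF \<sigma> \<tau>, of ?x] by simp
qed

end

context modulus_oper
begin

text \<open>Instead of passing to the common refinement of the sets occurring in the list, the
  induction splits \<open>\<tau>\<close> along one of them at a time; the vector \<open>g\<close> accumulates the terms whose
  set contains the current piece \<open>\<tau>\<close>.\<close>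

lemma comb_transfer:
  assumes \<Phi>_add: "\<And>a b a' b'. 0 \<le> a \<Longrightarrow> 0 \<le> a' \<Longrightarrow> 0 \<le> b \<Longrightarrow> 0 \<le> b' \<Longrightarrow> \<Phi> a b \<Longrightarrow> \<Phi> a' b' \<Longrightarrow>
      \<Phi> (a + a') (b + b' :: real)"
    and \<Phi>_base: "\<And>\<sigma> f. \<sigma> \<in> sets borel_Rplus \<Longrightarrow> f \<in> dom A \<Longrightarrow>
      \<Phi> ((norm (E \<sigma> (ap A f)))\<^sup>2) ((norm (E \<sigma> (ap B f)))\<^sup>2)"
    and "set xs \<subseteq> sets borel_Rplus \<times> dom A" "\<tau> \<in> sets borel_Rplus" "g \<in> dom A"
  shows "\<Phi> ((norm (E \<tau> (ap A g) + comb A \<tau> xs))\<^sup>2) ((norm (E \<tau> (ap B g) + comb B \<tau> xs))\<^sup>2)"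
  using assms(3-5)
proof (induction xs arbitrary: \<tau> g)
  case Nil
  then show ?case by (simp add: \<Phi>_base)
next
  case (Cons x xs)
  obtain \<sigma> f where x: "x = (\<sigma>, f)" by (cases x)
  have \<sigma>: "\<sigma> \<in> sets borel_Rplus" and f: "f \<in> dom A" and xs: "set xs \<subseteq> sets borel_Rplus \<times> dom A"
    using Cons.prems x by auto
  note s = sets.Int[OF Cons.prems(2) \<sigma>] sets.Diff[OF Cons.prems(2) \<sigma>]
  show ?case
    unfolding x comb_refine[OF A_lin f Cons.prems(3) \<sigma> Cons.prems(2) xs]
      comb_refine[OF B_lin f[folded dom_modulus] Cons.prems(3)[folded dom_modulus] \<sigma> Cons.prems(2) xs]
    by (intro \<Phi>_add Cons.IH xs s lin_oper_add(1)[OF A_lin] Cons.prems(3) f zero_le_power2)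
qed

text \<open>The graph of the prospective map: one list evaluated with both operators.
  Single-valuedness is proved separately, under the hypotheses that make it true.\<close>

definition related :: "'a \<Rightarrow> 'a \<Rightarrow> bool" where
  "related x y \<longleftrightarrow> (\<exists>xs. set xs \<subseteq> sets borel_Rplus \<times> dom A \<and> x = comb A {0..} xs \<and> y = comb B {0..} xs)"

lemma top_sets: "{0..} \<in> sets borel_Rplus"
  by (simp only: sets_borel_Rplus) simp

lemma top_Int: "\<sigma> \<in> sets borel_Rplus \<Longrightarrow> {0..} \<inter> \<sigma> = \<sigma>"
  unfolding sets_borel_Rplus by blast

lemma related_gen:
  assumes "\<sigma> \<in> sets borel_Rplus" "f \<in> dom A"
  shows "related (E \<sigma> (ap A f)) (E \<sigma> (ap B f))"
  unfolding related_def using assms by (intro exI[of _ "[(\<sigma>, f)]"]) (simp add: top_Int)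

lemma related_zero: "related 0 0"
  unfolding related_def by (intro exI[of _ "[]"]) simp

lemma related_add:
  assumes "related x y" "related x' y'"
  shows "related (x + x') (y + y')"
proof -
  obtain xs xs' where "set xs \<subseteq> sets borel_Rplus \<times> dom A" "x = comb A {0..} xs" "y = comb B {0..} xs"
    "set xs' \<subseteq> sets borel_Rplus \<times> dom A" "x' = comb A {0..} xs'" "y' = comb B {0..} xs'"
    using assms unfolding related_def by blast
  then show ?thesis
    unfolding related_def by (intro exI[of _ "xs @ xs'"]) (simp add: comb_append)
qed

lemma related_induct [consumes 1, case_names zero Cons]:
  assumes "related x y" "P 0 0"
    and "\<And>\<sigma> f x y. \<sigma> \<in> sets borel_Rplus \<Longrightarrow> f \<in> dom A \<Longrightarrow> P x y \<Longrightarrow>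
      P (E \<sigma> (ap A f) + x) (E \<sigma> (ap B f) + y)"
  shows "P x y"
proof -
  have "set xs \<subseteq> sets borel_Rplus \<times> dom A \<Longrightarrow> P (comb A {0..} xs) (comb B {0..} xs)" for xs
  proof (induction xs)
    case Nil
    show ?case using assms(2) by simp
  next
    case (Cons p xs)
    obtain \<sigma> f where p: "p = (\<sigma>, f)" by (cases p)
    show ?case
      using Cons assms(3)[of \<sigma> f] unfolding p by (simp add: top_Int)
  qed
  then show ?thesis
    using assms(1) unfolding related_def by blast
qed

lemma related_scaleC:
  assumes "related x y"
  shows "related (c *\<^sub>C x) (c *\<^sub>C y)"
  using assms
proof (induction rule: related_induct)
  case zero
  show ?case using related_zero by simp
next
  case (Cons \<sigma> f x y)
  have "related (E \<sigma> (ap A (c *\<^sub>C f))) (E \<sigma> (ap B (c *\<^sub>C f)))"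
    by (intro related_gen Cons lin_oper_scaleC A_lin)
  then show ?case
    using related_add[OF _ Cons(3)] Cons(1,2) dom_modulus
    by (simp add: lin_oper_scaleC[OF A_lin] lin_oper_scaleC[OF B_lin] E_scaleC scaleC_add_right)
qed

lemma related_E:
  assumes "related x y" and \<sigma>: "\<sigma> \<in> sets borel_Rplus"
  shows "related (E \<sigma> x) (E \<sigma> y)"
  using assms(1)
proof (induction rule: related_induct)
  case zero
  show ?case using related_zero by (simp add: E_zero[OF \<sigma>])
next
  case (Cons \<tau> f x y)
  then show ?case
    using related_add[OF related_gen[OF sets.Int[OF \<sigma> Cons(1)] Cons(2)] Cons(3)]
    by (simp add: E_add[OF \<sigma>] E_Int[OF \<sigma> Cons(1)])
qed

text \<open>The first components of related pairs form a subspace containing the generators, and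
  each is a sum of generators.\<close>

lemma H0_related: "x \<in> H0 A E \<longleftrightarrow> (\<exists>y. related x y)"
proof
  assume "x \<in> H0 A E"
  then show "\<exists>y. related x y"
    unfolding H0_def
  proof (induction rule: cvec.span_induct)
    case base
    show ?case
      unfolding cvec.subspace_def using related_zero related_add related_scaleC by blast
  next
    case (step x)
    then show ?case using related_gen by blast
  qed
next
  assume "\<exists>y. related x y"
  then obtain y where "related x y" ..
  then show "x \<in> H0 A E"
  proof (induction rule: related_induct)
    case zero
    show ?case unfolding H0_def by (rule cvec.span_zero)
  next
    case (Cons \<sigma> f x y)
    then have "E \<sigma> (ap A f) \<in> H0 A E"
      unfolding H0_def by (intro cvec.span_base) blast
    then show ?case
      using Cons(3) unfolding H0_def by (rule cvec.span_add)
  qed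
qed

text \<open>Since \<open>E\<close> commutes with \<open>B\<close>, each summand
  \<open>E \<sigma> (ap B f)\<close> is itself a value of \<open>B\<close>, and values of
  \<open>B\<close> add up.\<close>

lemma related_ran: "related x y \<Longrightarrow> \<exists>h\<in>dom B. y = ap B h"
proof (induction rule: related_induct)
  case zero
  have "ap B 0 = 0" "0 \<in> dom B"
    using B_diff[OF lin_oper_zero[OF B_lin] lin_oper_zero[OF B_lin]] lin_oper_zero[OF B_lin] by simp_all
  then show ?case by metis
next
  case (Cons \<sigma> f x y)
  then obtain h where h: "h \<in> dom B" "y = ap B h" by blast
  have f: "f \<in> dom B" using Cons(2) dom_modulus by simp
  have "E \<sigma> (ap B f) + y = ap B (E \<sigma> f + h)"
    using B_add(2)[OF E_dom[OF Cons(1) f] h(1)] h(2) E_B_commute[OF Cons(1) f] by simp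
  then show ?case
    using B_add(1)[OF E_dom[OF Cons(1) f] h(1)] by blast
qed

text \<open>\<open>\<Phi>\<close> unifies the two cases: it becomes
  \<open>a = 0 \<longrightarrow> b = 0\<close> for absolute continuity and
  \<open>b \<le> c * a\<close> for the norm bound. Passing from generators to all related pairs, it
  makes the relation the graph of a function.\<close>

lemma intertwiner_exists:
  assumes \<Phi>_add: "\<And>a b a' b'. 0 \<le> a \<Longrightarrow> 0 \<le> a' \<Longrightarrow> 0 \<le> b \<Longrightarrow> 0 \<le> b' \<Longrightarrow> \<Phi> a b \<Longrightarrow> \<Phi> a' b' \<Longrightarrow>
      \<Phi> (a + a') (b + b' :: real)"
    and \<Phi>_zero: "\<And>b. 0 \<le> b \<Longrightarrow> \<Phi> 0 b \<Longrightarrow> b = 0"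
    and \<Phi>_base: "\<And>\<sigma> f. \<sigma> \<in> sets borel_Rplus \<Longrightarrow> f \<in> dom A \<Longrightarrow>
      \<Phi> ((norm (E \<sigma> (ap A f)))\<^sup>2) ((norm (E \<sigma> (ap B f)))\<^sup>2)"
  shows "\<exists>T. intertwiner A B E T \<and> (\<forall>h\<in>dom T. \<Phi> ((norm h)\<^sup>2) ((norm (ap T h))\<^sup>2))"
proof -
  have \<Phi>: "\<Phi> ((norm x)\<^sup>2) ((norm y)\<^sup>2)" if xy: "related x y" for x y
  proof -
    obtain xs where xs: "set xs \<subseteq> sets borel_Rplus \<times> dom A" "x = comb A {0..} xs" "y = comb B {0..} xs"
      using xy unfolding related_def by blast
    \<comment> \<open>\<open>comb_transfer\<close> is used with the whole half-line as
      \<open>\<tau>\<close> and accumulator \<open>g = 0\<close>, so only the two sums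
      remain.\<close>
    have "ap A 0 = 0" "ap B 0 = 0"
      using lin_oper_diff(2)[OF A_lin lin_oper_zero[OF A_lin] lin_oper_zero[OF A_lin]]
        B_diff(2)[OF lin_oper_zero[OF B_lin] lin_oper_zero[OF B_lin]] by simp_all
    then show ?thesis
      using comb_transfer[of \<Phi>, OF \<Phi>_add \<Phi>_base xs(1) top_sets lin_oper_zero[OF A_lin]]
      unfolding xs(2,3) by (simp add: E_top)
  qed
  \<comment> \<open>The difference of two values is related to 0, where \<open>\<Phi>_zero\<close>
    forces it to vanish.\<close>
  have single: "y = y'" if "related x y" "related x y'" for x y y'
  proof -
    have "related (- x) (- y')"
      using related_scaleC[OF that(2), of "- 1"] by simp
    from related_add[OF that(1) this] have "related 0 (y - y')" by simp
    from \<Phi>[OF this] have "(norm (y - y'))\<^sup>2 = 0"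
      by (intro \<Phi>_zero) simp_all
    then show ?thesis by simp
  qed
  define T where "T x = (if x \<in> H0 A E then Some (THE y. related x y) else None)" for x
  have T: "T x = Some y" if "related x y" for x y
  proof -
    have "(THE y. related x y) = y"
      using that single by blast
    then show ?thesis
      using that H0_related unfolding T_def by auto
  qed
  have dom: "dom T = H0 A E"
    unfolding T_def dom_def by simp
  have ex: "\<exists>y. related x y" if "x \<in> dom T" for x
    using that unfolding dom H0_related .
  have "lin_oper T"
    unfolding lin_oper_def
  proof (intro conjI ballI allI)
    show "cvec.subspace (dom T)"
      unfolding dom H0_def by (rule cvec.subspace_span)
    show "ap T (f + g) = ap T f + ap T g" if fg: "f \<in> dom T" "g \<in> dom T" for f g
    proof -
      obtain y z where "related f y" "related g z" using ex[OF fg(1)] ex[OF fg(2)] by blast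
      then show ?thesis using T related_add by (metis option.sel)
    qed
    show "ap T (c *\<^sub>C f) = c *\<^sub>C ap T f" if f: "f \<in> dom T" for c f
    proof -
      obtain y where "related f y" using ex[OF f] ..
      then show ?thesis using T related_scaleC by (metis option.sel)
    qed
  qed
  moreover have "ran T \<subseteq> ran B"
  proof
    fix y assume "y \<in> ran T"
    then obtain x where x: "T x = Some y" unfolding ran_def by blast
    then obtain z where "related x z" using ex by blast
    then have "related x y" using T x by fastforce
    then obtain h where "h \<in> dom B" "y = ap B h" using related_ran by blast
    then show "y \<in> ran B" by (auto simp: ran_def)
  qed
  moreover have "T \<circ>\<^sub>m A = B"
  proof
    fix f
    show "(T \<circ>\<^sub>m A) f = B f"
    proof (cases "f \<in> dom A")
      case True
      then have "related (ap A f) (ap B f)"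
        using related_gen[OF top_sets True] by (simp add: E_top)
      then have "T (ap A f) = Some (ap B f)" by (rule T)
      moreover have "f \<in> dom B" using True dom_modulus by simp
      ultimately show ?thesis using True by (auto simp: map_comp_def)
    next
      case False
      then have "A f = None" "B f = None"
        using dom_modulus by (metis domIff)+
      then show ?thesis by simp
    qed
  qed
  moreover have "T (E \<sigma> h) = Some (E \<sigma> (ap T h))" if h: "\<sigma> \<in> sets borel_Rplus" "h \<in> H0 A E" for \<sigma> h
  proof -
    obtain y where y: "related h y" using h(2) unfolding H0_related ..
    show ?thesis using T[OF related_E[OF y h(1)]] T[OF y] by simp
  qed
  moreover have "\<Phi> ((norm h)\<^sup>2) ((norm (ap T h))\<^sup>2)" if h: "h \<in> dom T" for h
  proof -
    obtain y where y: "related h y" using ex[OF h] ..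
    show ?thesis using T[OF y] \<Phi>[OF y] by simp
  qed
  ultimately show ?thesis
    unfolding intertwiner_def using dom by blast
qed

lemma intertwiner_gen:
  assumes "intertwiner A B E T" "\<sigma> \<in> sets borel_Rplus" "f \<in> dom A"
  shows "E \<sigma> (ap A f) \<in> dom T" "ap T (E \<sigma> (ap A f)) = E \<sigma> (ap B f)"
proof -
  have dom: "dom T = H0 A E" and comp: "T \<circ>\<^sub>m A = B"
    and comm: "\<And>\<sigma> h. \<sigma> \<in> sets borel_Rplus \<Longrightarrow> h \<in> H0 A E \<Longrightarrow> T (E \<sigma> h) = Some (E \<sigma> (ap T h))"
    using assms(1) unfolding intertwiner_def by auto
  have "related (ap A f) (ap B f)"
    using related_gen[OF top_sets assms(3)] by (simp add: E_top)
  then have H: "ap A f \<in> H0 A E" using H0_related by blast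
  have "ap T (ap A f) = ap B f"
    using map_comp_SomeI[of f A T] assms(3) H dom comp by simp
  then have "T (E \<sigma> (ap A f)) = Some (E \<sigma> (ap B f))"
    using comm[OF assms(2) H] by simp
  then show "E \<sigma> (ap A f) \<in> dom T" "ap T (E \<sigma> (ap A f)) = E \<sigma> (ap B f)" by auto
qed

text \<open>The values on the generators are forced by \<open>T \<circ>\<^sub>m A = B\<close> and
  commutation with \<open>E\<close>; linearity forces the rest. Uniqueness follows.\<close>

lemma intertwiner_related:
  assumes T: "intertwiner A B E T" and "related x y"
  shows "T x = Some y"
proof -
  have lin: "lin_oper T" using T unfolding intertwiner_def by blast
  from assms(2) have "x \<in> dom T \<and> ap T x = y"
  proof (induction rule: related_induct)
    case zero
    show ?case
      using lin_oper_diff(2)[OF lin lin_oper_zero[OF lin] lin_oper_zero[OF lin]] lin_oper_zero[OF lin]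
      by simp
  next
    case (Cons \<sigma> f x y)
    then show ?case
      using lin_oper_add[OF lin intertwiner_gen(1)[OF T Cons(1,2)], of x] intertwiner_gen(2)[OF T Cons(1,2)]
      by simp
  qed
  then show ?thesis by auto
qed

lemma intertwiner_unique:
  assumes "intertwiner A B E T" "intertwiner A B E T'"
  shows "T = T'"
proof
  fix x
  show "T x = T' x"
  proof (cases "x \<in> H0 A E")
    case True
    then obtain y where "related x y" using H0_related by blast
    from intertwiner_related[OF assms(1) this] intertwiner_related[OF assms(2) this]
    show ?thesis by simp
  next
    case False
    then have "x \<notin> dom T" "x \<notin> dom T'"
      using assms unfolding intertwiner_def by blast+
    then show ?thesis by (simp add: domIff)
  qed
qed

text \<open>In terms of null sets, absolute continuity says that
  \<open>E \<sigma> (ap A f) = 0\<close> implies \<open>E \<sigma> (ap B f) = 0\<close>. Conversely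
  an intertwiner maps the first vector to the second and 0 to 0.\<close>

lemma intertwiner_iff_absolutely_continuous:
  "(\<forall>f\<in>dom A. absolutely_continuous (vec_measure E (ap A f)) (vec_measure E (ap B f))) \<longleftrightarrow>
    (\<exists>T. intertwiner A B E T)"
proof -
  have ac: "absolutely_continuous (vec_measure E x) (vec_measure E y) \<longleftrightarrow>
      (\<forall>\<sigma>\<in>sets borel_Rplus. E \<sigma> x = 0 \<longrightarrow> E \<sigma> y = 0)" for x y
    unfolding absolutely_continuous_def subset_iff null_sets_vec_measure by blast
  show ?thesis
    unfolding ac
  proof
    assume "\<forall>f\<in>dom A. \<forall>\<sigma>\<in>sets borel_Rplus. E \<sigma> (ap A f) = 0 \<longrightarrow> E \<sigma> (ap B f) = 0"
    then have "\<exists>T. intertwiner A B E T \<and>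
        (\<forall>h\<in>dom T. (\<lambda>a b. a = 0 \<longrightarrow> b = 0) ((norm h)\<^sup>2) ((norm (ap T h))\<^sup>2))"
      by (intro intertwiner_exists) (auto simp: add_nonneg_eq_0_iff)
    then show "\<exists>T. intertwiner A B E T" by blast
  next
    assume "\<exists>T. intertwiner A B E T"
    then obtain T where T: "intertwiner A B E T" ..
    then have "lin_oper T" unfolding intertwiner_def by blast
    then have "ap T 0 = 0"
      using lin_oper_diff(2)[of T 0 0] lin_oper_zero[of T] by simp
    then show "\<forall>f\<in>dom A. \<forall>\<sigma>\<in>sets borel_Rplus. E \<sigma> (ap A f) = 0 \<longrightarrow> E \<sigma> (ap B f) = 0"
      using intertwiner_gen(2)[OF T] by metis
  qed
qed

section \<open>Weak quasinormality\<close>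

text \<open>The existential over moduli and spectral measures collapses to the given pair by
  uniqueness. Spectral measures agree only on Borel subsets of the half-line, which is all the bound
  refers to.\<close>

lemma wq_bound_iff:
  "wq_bound A c \<longleftrightarrow> 0 \<le> c \<and> (\<forall>\<sigma>\<in>sets borel_Rplus. \<forall>f\<in>dom A.
    (norm (E \<sigma> (ap B f)))\<^sup>2 \<le> c * (norm (E \<sigma> (ap A f)))\<^sup>2)"
proof -
  have n: "Re (cinner (E \<sigma> h) h) = (norm (E \<sigma> h))\<^sup>2" if "\<sigma> \<in> sets borel_Rplus" for \<sigma> h
    using E_inner[OF that] by (simp add: inner_eq_Re_cinner)
  have uniq: "B' = B \<and> (\<forall>\<sigma>\<in>sets borel_Rplus. E' \<sigma> = E \<sigma>)"
    if "is_modulus A B'" "is_spectral_measure_of B' E'" for B' E'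
  proof -
    interpret m: modulus_oper A B' E'
      using that A_lin A_closed A_dense by unfold_locales
    have s: "spectral_oper E' B'" "spectral_oper E B" by unfold_locales
    have "B' \<circ>\<^sub>m B' = B \<circ>\<^sub>m B"
      using modulus that(1) unfolding is_modulus_def by simp
    then show ?thesis
      using square_root_unique[OF s] spectral_measure_unique[OF s] by blast
  qed
  let ?P = "\<lambda>B E. \<forall>\<sigma>\<in>sets borel_Rplus. \<forall>f\<in>dom A.
    Re (cinner (E \<sigma> (ap B f)) (ap B f)) \<le> c * Re (cinner (E \<sigma> (ap A f)) (ap A f))"
  have "(\<exists>B' E'. is_modulus A B' \<and> is_spectral_measure_of B' E' \<and> ?P B' E') \<longleftrightarrow> ?P B E"
  proof
    assume "\<exists>B' E'. is_modulus A B' \<and> is_spectral_measure_of B' E' \<and> ?P B' E'"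
    then obtain B' E' where *: "is_modulus A B'" "is_spectral_measure_of B' E'" "?P B' E'" by blast
    have "B' = B" "\<And>\<sigma>. \<sigma> \<in> sets borel_Rplus \<Longrightarrow> E' \<sigma> = E \<sigma>"
      using uniq[OF *(1,2)] by blast+
    then show "?P B E" using *(3) by simp
  next
    assume "?P B E"
    then show "\<exists>B' E'. is_modulus A B' \<and> is_spectral_measure_of B' E' \<and> ?P B' E'"
      using modulus spectral_modulus by blast
  qed
  then show ?thesis
    unfolding wq_bound_def by (simp add: n)
qed

text \<open>A \<open>LEAST\<close> over the reals must be shown to be attained: the admissible
  bounds form an intersection of closed sets, bounded below by 0, so their infimum is
  admissible.\<close>

lemma wq_const_least:
  assumes "wq_bound A c"
  shows "wq_bound A (wq_const A)" "wq_const A \<le> c"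
proof -
  let ?S = "{c. wq_bound A c}"
  have "?S = {0..} \<inter> (\<Inter>\<sigma>\<in>sets borel_Rplus. \<Inter>f\<in>dom A.
      {c. (norm (E \<sigma> (ap B f)))\<^sup>2 \<le> c * (norm (E \<sigma> (ap A f)))\<^sup>2})"
    unfolding wq_bound_iff by auto
  also have "closed \<dots>"
    by (intro closed_Int closed_INT ballI closed_atLeast closed_Collect_le continuous_intros)
  finally have cl: "closed ?S" .
  have bdd: "bdd_below ?S"
    unfolding wq_bound_iff by (rule bdd_belowI[of _ 0]) blast
  have I: "wq_bound A (Inf ?S)"
    using closed_contains_Inf[OF _ bdd cl] assms by blast
  moreover have le: "Inf ?S \<le> c" if "wq_bound A c" for c
    using that bdd by (intro cInf_lower) simp_all
  ultimately have "wq_const A = Inf ?S"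
    unfolding wq_const_def by (rule Least_equality)
  then show "wq_bound A (wq_const A)" "wq_const A \<le> c"
    using I le[OF assms] by simp_all
qed

lemma weakly_quasinormal_iff:
  assumes "0 \<le> c"
  shows "weakly_quasinormal A \<and> wq_const A \<le> c \<longleftrightarrow> wq_bound A c"
proof
  assume *: "weakly_quasinormal A \<and> wq_const A \<le> c"
  then obtain c0 where "wq_bound A c0" unfolding weakly_quasinormal_def by blast
  then have w: "wq_bound A (wq_const A)" by (rule wq_const_least(1))
  have "(norm (E \<sigma> (ap B f)))\<^sup>2 \<le> c * (norm (E \<sigma> (ap A f)))\<^sup>2"
    if "\<sigma> \<in> sets borel_Rplus" "f \<in> dom A" for \<sigma> f
  proof -
    have "(norm (E \<sigma> (ap B f)))\<^sup>2 \<le> wq_const A * (norm (E \<sigma> (ap A f)))\<^sup>2"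
      using w that unfolding wq_bound_iff by blast
    also have "\<dots> \<le> c * (norm (E \<sigma> (ap A f)))\<^sup>2"
      using * by (intro mult_right_mono) simp_all
    finally show ?thesis .
  qed
  then show "wq_bound A c"
    unfolding wq_bound_iff using assms by blast
next
  assume "wq_bound A c"
  then show "weakly_quasinormal A \<and> wq_const A \<le> c"
    using wq_const_least(2) A_lin A_closed A_dense unfolding weakly_quasinormal_def by blast
qed

end

text \<open>Boundedness is what gives the real supremum its meaning; at \<open>h = 0\<close> the
  quotient is \<open>0 / 0 = 0\<close>, which explains \<open>0 \<le> M\<close>.\<close>

lemma oper_norm_le_iff:
  assumes "lin_oper T" "0 \<le> M"
  shows "bounded_oper T \<and> oper_norm T \<le> M \<longleftrightarrow> (\<forall>h\<in>dom T. norm (ap T h) \<le> M * norm h)"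
proof
  have T0: "ap T 0 = 0"
    using lin_oper_diff(2)[OF assms(1) lin_oper_zero[OF assms(1)] lin_oper_zero[OF assms(1)]] by simp
  have quot: "norm (ap T h) / norm h \<le> K" if "norm (ap T h) \<le> K * norm h" "0 \<le> K" for h K
    using that T0 by (cases "h = 0") (simp_all add: pos_divide_le_eq)
  show "\<forall>h\<in>dom T. norm (ap T h) \<le> M * norm h" if T: "bounded_oper T \<and> oper_norm T \<le> M"
  proof
    fix h assume h: "h \<in> dom T"
    obtain K where K: "\<And>h. h \<in> dom T \<Longrightarrow> norm (ap T h) \<le> K * norm h"
      using T unfolding bounded_oper_def by blast
    \<comment> \<open>If the domain is trivial, \<open>K\<close> may be negative and fails to bound
      the quotient at 0.\<close>
    have "norm (ap T h) \<le> max K 0 * norm h" if "h \<in> dom T" for h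
      using K[OF that] mult_right_mono[of K "max K 0" "norm h"] by simp
    then have "bdd_above ((\<lambda>h. norm (ap T h) / norm h) ` dom T)"
      by (intro bdd_aboveI2[of _ _ "max K 0"] quot) simp_all
    then have "norm (ap T h) / norm h \<le> M"
      using cSUP_upper[OF h, of "\<lambda>h. norm (ap T h) / norm h"] T unfolding oper_norm_def by simp
    then show "norm (ap T h) \<le> M * norm h"
      using T0 by (cases "h = 0") (simp_all add: pos_divide_le_eq)
  qed
  show "bounded_oper T \<and> oper_norm T \<le> M" if "\<forall>h\<in>dom T. norm (ap T h) \<le> M * norm h"
  proof
    show "bounded_oper T"
      using that unfolding bounded_oper_def by blast
    show "oper_norm T \<le> M"
      unfolding oper_norm_def
    proof (rule cSUP_least)
      show "dom T \<noteq> {}"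
        using lin_oper_zero[OF assms(1)] by blast
      show "norm (ap T h) / norm h \<le> M" if "h \<in> dom T" for h
        using \<open>\<forall>h\<in>dom T. _\<close> that quot assms(2) by blast
    qed
  qed
qed

text \<open>The squared inequality on generators extends to \<open>H0\<close> through
  \<open>intertwiner_exists\<close>, and a square root gives the norm bound. Conversely the norm
  bound is evaluated at the vectors \<open>E \<sigma> (ap A f)\<close>.\<close>

lemma (in modulus_oper) wq_bound_iff_intertwiner:
  assumes c: "0 \<le> c"
  shows "wq_bound A c \<longleftrightarrow> (\<exists>T. intertwiner A B E T \<and> bounded_oper T \<and> oper_norm T \<le> sqrt c)"
proof
  assume "wq_bound A c"
  then have "\<exists>T. intertwiner A B E T \<and>
      (\<forall>h\<in>dom T. (\<lambda>a b. b \<le> c * a) ((norm h)\<^sup>2) ((norm (ap T h))\<^sup>2))"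
    unfolding wq_bound_iff by (intro intertwiner_exists) (auto simp: algebra_simps)
  then obtain T where T: "intertwiner A B E T" and le: "\<And>h. h \<in> dom T \<Longrightarrow> (norm (ap T h))\<^sup>2 \<le> c * (norm h)\<^sup>2"
    by blast
  have "norm (ap T h) \<le> sqrt c * norm h" if "h \<in> dom T" for h
    using real_sqrt_le_mono[OF le[OF that]] by (simp add: real_sqrt_mult)
  moreover have "lin_oper T"
    using T unfolding intertwiner_def by blast
  ultimately show "\<exists>T. intertwiner A B E T \<and> bounded_oper T \<and> oper_norm T \<le> sqrt c"
    using T c oper_norm_le_iff[of T "sqrt c"] by auto
next
  assume "\<exists>T. intertwiner A B E T \<and> bounded_oper T \<and> oper_norm T \<le> sqrt c"
  then obtain T where T: "intertwiner A B E T" and b: "bounded_oper T \<and> oper_norm T \<le> sqrt c" by blast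
  have "lin_oper T"
    using T unfolding intertwiner_def by blast
  then have le: "norm (ap T h) \<le> sqrt c * norm h" if "h \<in> dom T" for h
    using b that c oper_norm_le_iff[of T "sqrt c"] by simp
  have "(norm (E \<sigma> (ap B f)))\<^sup>2 \<le> c * (norm (E \<sigma> (ap A f)))\<^sup>2"
    if "\<sigma> \<in> sets borel_Rplus" "f \<in> dom A" for \<sigma> f
    using power_mono[OF le[OF intertwiner_gen(1)[OF T that]], of 2] c
    unfolding intertwiner_gen(2)[OF T that] by (simp add: power_mult_distrib)
  then show "wq_bound A c"
    unfolding wq_bound_iff using c by blast
qed

theorem theorem4p4:
  fixes A absA :: "'a::chilbert_space oper"
    and E :: "real set \<Rightarrow> 'a \<Rightarrow> 'a"
  assumes "lin_oper A" and "closed_oper A" and "densely_defined A"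
    and "is_modulus A absA"
    and "is_spectral_measure_of absA E"
  shows
    "((\<forall>f\<in>dom A. absolutely_continuous (vec_measure E (ap A f)) (vec_measure E (ap absA f)))
        \<longleftrightarrow> (\<exists>T0. intertwiner A absA E T0)) \<and>
     (\<forall>T0 T0'. intertwiner A absA E T0 \<longrightarrow> intertwiner A absA E T0' \<longrightarrow> T0 = T0') \<and>
     (\<forall>c\<ge>0. (weakly_quasinormal A \<and> wq_const A \<le> c) \<longleftrightarrow>
        (\<exists>T0. intertwiner A absA E T0 \<and> bounded_oper T0 \<and> oper_norm T0 \<le> sqrt c))"
proof -
  interpret modulus_oper A absA E
    using assms by unfold_locales
  show ?thesis
    using intertwiner_iff_absolutely_continuous intertwiner_unique weakly_quasinormal_iff
      wq_bound_iff_intertwiner by simp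
qed

end
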